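(* Let $h\in\mathcal S(\mathbb R)$ be non-vanishing at a point $a\in\mathbb R$. For $f\in\mathcal S(\mathbb R^n)$, we have for $u=(u_1,u')\in\mathbb R\times\mathbb R^{n-1}$ $$ |\sigma|\,\widehat{P_hf}(\sigma,u',a\sigma,v')=2\pi\,\hat f(\sigma,av'+u')\,h(a). $$ Here $\hat f$ is the Fourier transform of $f$ with respect to the first variable $x_1$, and $\widehat{P_hf}$ is the 2-dimensional Fourier transform of $P_hf$ with respect to the two variables $(u_1,v_1)$.
   Context: $\mathcal S(\mathbb R^d)$ is the Schwartz space. For $f\in\mathcal S(\mathbb R^n)$ and $h\in\mathcal S(\mathbb R)$ the windowed ray transform is $$P_hf(u,v)=\int_{\mathbb R}f(u+tv)h(t)\,dt,\qquad (u,v)\in\mathbb R^n\times(\mathbb R^n\setminus\{0\}).$$ Write $v=(v_1,v')\in\mathbb R\times\mathbb R^{n-1}$, as for $u=(u_1,u')$. The Fourier variable $\sigma$ is dual to $u_1$ (respectively $x_1$), and in $\widehat{P_hf}(\sigma,u',\eta,v')$ the variable $\eta$ is dual to $v_1$. The Fourier convention has kernel $e^{-i\sigma x_1}$ in one variable and $e^{-i(\sigma u_1+\eta v_1)}$ in the two variables $(u_1,v_1)$.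
   Formalization: The identity is proved for σ ≠ 0 only: at σ = 0 the Fourier transform of P_h f (taken as a tempered distribution, since P_h f is not integrable in (u_1,v_1)) has in general no value at (0,0), and the left side would be 0 while the right side need not vanish. *)

theory Defs
  imports "HOL-Analysis.Analysis"
begin

fun iter_partial :: "'a list \<Rightarrow> ('a::euclidean_space \<Rightarrow> complex) \<Rightarrow> 'a \<Rightarrow> complex" where
  "iter_partial [] f = f"
| "iter_partial (b # bs) f = (\<lambda>x. frechet_derivative (iter_partial bs f) (at x) b)"

definition schwartz :: "('a::euclidean_space \<Rightarrow> complex) \<Rightarrow> bool" where
  "schwartz f \<longleftrightarrow>
     (\<forall>bs \<in> lists Basis.
        (\<forall>x. iter_partial bs f differentiable (at x)) \<and>
        (\<forall>k::nat. \<exists>C. \<forall>x. norm x ^ k * norm (iter_partial bs f x) \<le> C))"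

definition fourier :: "('a::euclidean_space \<Rightarrow> complex) \<Rightarrow> 'a \<Rightarrow> complex" where
  "fourier \<phi> \<xi> = (LINT x|lborel. exp (- (\<i> * complex_of_real (\<xi> \<bullet> x))) * \<phi> x)"

text \<open>The windowed ray transform is bounded but in general not integrable in the variables
  \<open>(u\<^sub>1, v\<^sub>1)\<close> (it only decays like \<open>1/|v\<^sub>1|\<close>), so the integral \<^const>\<open>fourier\<close> does not define its
  two-dimensional Fourier transform. The transform is taken in the sense of tempered
  distributions: \<open>G\<close> represents the Fourier transform of \<open>F\<close> if
  \<open>\<integral> F \<phi>\<^sup>\<and> = \<integral> G \<phi>\<close> for every Schwartz function \<open>\<phi>\<close>.\<close>

definition represents_fourier ::
    "('a::euclidean_space \<Rightarrow> complex) \<Rightarrow> ('a \<Rightarrow> complex) \<Rightarrow> bool" where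
  "represents_fourier F G \<longleftrightarrow>
     (\<forall>\<phi>. schwartz \<phi> \<longrightarrow>
        integrable lborel (\<lambda>x. F x * fourier \<phi> x) \<and>
        integrable lborel (\<lambda>\<xi>. G \<xi> * \<phi> \<xi>) \<and>
        (LINT x|lborel. F x * fourier \<phi> x) = (LINT \<xi>|lborel. G \<xi> * \<phi> \<xi>))"

text \<open>A representing function is determined only almost everywhere; its value at \<open>\<xi>\<close> is meaningful,
  and unique, when the representative is continuous at \<open>\<xi>\<close>.\<close>

definition has_fourier_value :: "('a::euclidean_space \<Rightarrow> complex) \<Rightarrow> 'a \<Rightarrow> complex \<Rightarrow> bool" where
  "has_fourier_value F \<xi> c \<longleftrightarrow> (\<exists>G. represents_fourier F G \<and> isCont G \<xi> \<and> G \<xi> = c)"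

definition fourier_distr :: "('a::euclidean_space \<Rightarrow> complex) \<Rightarrow> 'a \<Rightarrow> complex" where
  "fourier_distr F \<xi> = (THE c. has_fourier_value F \<xi> c)"

definition windowed_ray ::
    "(real \<Rightarrow> complex) \<Rightarrow> (real^'n \<Rightarrow> complex) \<Rightarrow> real^'n \<Rightarrow> real^'n \<Rightarrow> complex" where
  "windowed_ray h f u v = (LINT t|lborel. f (u + t *\<^sub>R v) * h t)"

text \<open>The splitting \<open>(s, x') \<in> \<real> \<times> \<real>\<^sup>n\<^sup>-\<^sup>1\<close>: the coordinates of \<open>x'\<close> are the ones with index other
  than \<open>1\<close> (the entry \<open>x' $ 1\<close> is ignored). In this way every \<open>n \<ge> 1\<close> is covered, although there
  is no Cartesian product type of dimension \<open>0\<close>.\<close>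

definition join1 :: "real \<Rightarrow> real^'n::{finite,one} \<Rightarrow> real^'n::{finite,one}" where
  "join1 s x' = (\<chi> i. if i = 1 then s else x' $ i)"

definition fourier_x1 :: "(real^'n::{finite,one} \<Rightarrow> complex) \<Rightarrow> real \<Rightarrow> real^'n::{finite,one} \<Rightarrow> complex" where
  "fourier_x1 f \<sigma> x' = fourier (\<lambda>x\<^sub>1. f (join1 x\<^sub>1 x')) \<sigma>"

definition windowed_ray_slice ::
    "(real \<Rightarrow> complex) \<Rightarrow> (real^'n::{finite,one} \<Rightarrow> complex) \<Rightarrow> real^'n::{finite,one} \<Rightarrow> real^'n::{finite,one}
      \<Rightarrow> real \<times> real \<Rightarrow> complex" where
  "windowed_ray_slice h f u' v' = (\<lambda>(u\<^sub>1, v\<^sub>1). windowed_ray h f (join1 u\<^sub>1 u') (join1 v\<^sub>1 v'))"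

end

theory Submission
  imports Defs "HOL-Probability.Probability"
begin

text \<open>Put \<open>k(s, t) = f(s, u' + tv') h(t)\<close>, so that the slice is \<open>F(u, v) = \<integral> k(u + tv, t) dt\<close>. Pairing \<open>F\<close> with
  \<open>\<phi>\<^sup>\<and>\<close> and substituting \<open>w = u + tv\<close> leaves \<open>\<integral> \<phi>\<^sup>\<and>(w - tv, v) dv\<close>, which one-dimensional Fourier inversion
  evaluates to \<open>2\<pi> \<integral> exp (-iw\<sigma>) \<phi>(\<sigma>, t\<sigma>) d\<sigma>\<close>. Integrating against \<open>k\<close> in \<open>w\<close> and substituting \<open>\<eta> = t\<sigma>\<close> shows
  that \<open>G(\<sigma>, \<eta>) = 2\<pi>/|\<sigma>| k\<^sup>\<and>(\<sigma>, \<eta>/\<sigma>)\<close> represents the transform, with \<open>k\<^sup>\<and>\<close> taken in the first variable.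
  \<open>G\<close> is continuous off \<open>\<sigma> = 0\<close>, and Gaussian test functions determine its values there.\<close>

subsection \<open>Dominated integrals\<close>

text \<open>Since the slice \<open>F\<close> is merely bounded, all decay in \<open>(u, v)\<close>
  has to come from the test side. This is why the Fourier transform of a Schwartz
  \<open>\<phi>\<close> receives an explicit integrable bound, obtained from two derivatives in each
  variable. The representative \<open>G\<close> has the opposite defect, a factor
  \<open>1/|\<sigma>|\<close> that is not integrable near 0 by itself. It is harmless because
  \<open>G\<close> depends on \<open>\<eta>\<close> through \<open>\<eta>/\<sigma>\<close> and
  decays in that quotient: the region of \<open>\<eta>\<close> that matters shrinks like
  \<open>|\<sigma>|\<close>. One weight carries all estimates: \<open>lorentz\<close>, the
  unnormalised Cauchy density, a simple power decay that is integrable on the line. Products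
  \<open>C * lorentz x * lorentz y\<close> dominate most double integrals. Gaussians serve as test
  functions because their iterated partial derivatives remain polynomial multiples of the same
  Gaussian, so the Schwartz property follows by induction on the list of directions.\<close>

definition lorentz :: "real \<Rightarrow> real" where
  "lorentz x = inverse (1 + x\<^sup>2)"

lemma lorentz_pos: "0 < lorentz x" and lorentz_nonneg [simp]: "0 \<le> lorentz x"
  by (simp_all add: lorentz_def add_pos_nonneg)

lemma lorentz_le_1: "lorentz x \<le> 1"
  by (simp add: lorentz_def inverse_le_1_iff)

lemma integrable_lorentz: "integrable lborel lorentz"
  using integrable_inverse_1_plus_square
  by (simp add: set_integrable_def lorentz_def[abs_def] einterval_def)

lemma lorentz_tendsto_0: "(lorentz \<longlongrightarrow> 0) at_infinity"
proof -
  have "filterlim (\<lambda>x::real. 1 + x\<^sup>2) at_top at_infinity"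
    unfolding at_infinity_eq_at_top_bot
    by (intro filterlim_sup; intro filterlim_tendsto_add_at_top[OF tendsto_const])
       (auto intro: filterlim_pow_at_top filterlim_pow_at_bot_even filterlim_ident)
  from tendsto_inverse_0_at_top[OF this] show ?thesis
    by (simp add: lorentz_def[abs_def])
qed

text \<open>A Peetre inequality: a translation costs a factor that is only quadratic in the shift.
  The first estimate of the proof is \<open>(x + 2 * y)\<^sup>2 \<ge> 0\<close> rearranged.\<close>

lemma lorentz_add_le: "lorentz (x + y) \<le> 2 * (1 + y\<^sup>2) * lorentz x"
proof -
  have "x\<^sup>2 \<le> 2 * (x + y)\<^sup>2 + 2 * y\<^sup>2"
    using zero_le_power2[of "x + 2 * y"] by (simp add: power2_eq_square algebra_simps)
  moreover have "2 * (1 + y\<^sup>2) * (1 + (x + y)\<^sup>2) = 2 + 2 * y\<^sup>2 + 2 * (x + y)\<^sup>2 + 2 * ((x + y)\<^sup>2 * y\<^sup>2)"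
    by (simp only: distrib_left distrib_right mult_1_right mult_1_left) (simp add: mult_ac)
  moreover have "0 \<le> (x + y)\<^sup>2 * y\<^sup>2" by simp
  ultimately have "1 + x\<^sup>2 \<le> 2 * (1 + y\<^sup>2) * (1 + (x + y)\<^sup>2)"
    by linarith
  moreover have "0 < 1 + x\<^sup>2" "0 < 1 + (x + y)\<^sup>2"
    by (simp_all add: add_pos_nonneg)
  ultimately show ?thesis
    unfolding lorentz_def by (simp add: field_simps)
qed

text \<open>Dominated convergence along sequences, which detect continuity in a metric
  space.\<close>

lemma isCont_integral_dominated:
  fixes f :: "'a::metric_space \<Rightarrow> 'b \<Rightarrow> 'c::{banach, second_countable_topology}"
  assumes "\<And>x. f x \<in> borel_measurable M" and "integrable M w"
    and "\<And>x y. norm (f x y) \<le> w y" and "\<And>y. isCont (\<lambda>x. f x y) a"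
  shows "isCont (\<lambda>x. LINT y|M. f x y) a"
  unfolding continuous_at_sequentially comp_def
proof (intro allI impI)
  fix X :: "nat \<Rightarrow> 'a" assume "X \<longlonglongrightarrow> a"
  then show "(\<lambda>n. LINT y|M. f (X n) y) \<longlonglongrightarrow> (LINT y|M. f a y)"
    using assms
    by (intro integral_dominated_convergence[where w=w])
       (auto simp: continuous_at_sequentially comp_def)
qed

text \<open>Tonelli: the inner integral of \<open>norm g\<close> is at most \<open>P x\<close> times
  the integral of \<open>Q\<close>. Continuity of \<open>g\<close> supplies joint
  measurability.\<close>

lemma integrable_dominated_prod:
  fixes g :: "'a::euclidean_space \<times> 'b::euclidean_space \<Rightarrow> complex"
  assumes g: "continuous_on UNIV g" and P: "integrable lborel P" and Q: "integrable lborel Q"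
    and bound: "\<And>x y. norm (g (x, y)) \<le> P x * Q y"
  shows "integrable (lborel \<Otimes>\<^sub>M lborel) g"
proof -
  have [measurable]: "g \<in> borel_measurable borel"
    using g by (rule borel_measurable_continuous_onI)
  have [measurable]: "g \<in> borel_measurable (lborel \<Otimes>\<^sub>M lborel)"
    by (simp add: lborel_prod)
  have g_le: "norm (g (x, y)) \<le> norm (P x * Q y)" for x y
    using bound[of x y] by simp
  have int_y: "integrable lborel (\<lambda>y. g (x, y))" for x
    by (rule Bochner_Integration.integrable_bound[OF integrable_mult_right[OF Q, of "P x"]])
       (use g_le in auto)
  show ?thesis
  proof (rule lborel_pair.Fubini_integrable)
    show "integrable lborel (\<lambda>x. LINT y|lborel. norm (g (x, y)))"
    proof (rule Bochner_Integration.integrable_bound[OF integrable_mult_left[OF P, of "integral\<^sup>L lborel Q"]])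
      show "AE x in lborel. norm (LINT y|lborel. norm (g (x, y))) \<le> norm (P x * integral\<^sup>L lborel Q)"
      proof (intro AE_I2)
        fix x
        have "norm (LINT y|lborel. norm (g (x, y))) = (LINT y|lborel. norm (g (x, y)))"
          by simp
        also have "\<dots> \<le> (LINT y|lborel. P x * Q y)"
          by (intro integral_mono bound integrable_norm int_y integrable_mult_right Q)
        also have "\<dots> \<le> norm (P x * integral\<^sup>L lborel Q)"
          by simp
        finally show "norm (LINT y|lborel. norm (g (x, y))) \<le> norm (P x * integral\<^sup>L lborel Q)" .
      qed
    qed auto
  qed (use int_y in auto)
qed

lemma integral_swap_dominated:
  fixes g :: "'a::euclidean_space \<Rightarrow> 'b::euclidean_space \<Rightarrow> complex"
  assumes "continuous_on UNIV (\<lambda>(x, y). g x y)"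
    and "integrable lborel P" "integrable lborel Q"
    and "\<And>x y. norm (g x y) \<le> P x * Q y"
  shows "(LINT x|lborel. LINT y|lborel. g x y) = (LINT y|lborel. LINT x|lborel. g x y)"
  using integrable_dominated_prod[OF assms(1-3)] assms(4)
  by (intro lborel_pair.Fubini_integral[symmetric]) auto

lemma integral_prod_dominated:
  fixes g :: "'a::euclidean_space \<Rightarrow> 'b::euclidean_space \<Rightarrow> complex"
  assumes "continuous_on UNIV (\<lambda>(x, y). g x y)"
    and "integrable lborel P" "integrable lborel Q"
    and "\<And>x y. norm (g x y) \<le> P x * Q y"
  shows "(LINT x|lborel. LINT y|lborel. g x y) = (LINT (x, y)|lborel. g x y)"
  using integrable_dominated_prod[OF assms(1-3)] assms(4)
  by (subst lborel_pair.integral_fst) (auto simp: lborel_prod)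

subsection \<open>Fourier inversion at the origin\<close>

lemma fourier_real: "fourier \<phi> \<xi> = (LINT x|lborel. exp (- (\<i> * of_real (\<xi> * x))) * \<phi> x)" for \<xi> :: real
  by (simp add: fourier_def)

lemma norm_iexp [simp]: "norm (exp (- (\<i> * complex_of_real x))) = 1"
  by (simp add: norm_exp_eq_Re)

lemma norm_fourier_le: "norm (fourier \<phi> \<xi>) \<le> (LINT x|lborel. norm (\<phi> x))"
  unfolding fourier_def
  using integral_norm_bound[of lborel "\<lambda>x. exp (- (\<i> * complex_of_real (\<xi> \<bullet> x))) * \<phi> x"]
  by (simp add: norm_mult)

lemma continuous_fourier:
  fixes \<phi> :: "'a::euclidean_space \<Rightarrow> complex"
  assumes "integrable lborel \<phi>"
  shows "continuous_on UNIV (fourier \<phi>)"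
  unfolding fourier_def continuous_on_eq_continuous_at[OF open_UNIV]
  using assms
  by (intro ballI isCont_integral_dominated[where w="\<lambda>x. norm (\<phi> x)"])
     (auto simp: norm_mult intro!: continuous_intros)

text \<open>A characteristic function has kernel \<open>exp (i t x)\<close>, so the argument changes
  sign. Its value \<open>exp (- \<xi>\<^sup>2 / 2)\<close> is the density freed from its normalising
  factor.\<close>

lemma fourier_std_normal_density:
  "fourier (\<lambda>x. of_real (std_normal_density x)) \<xi> = of_real (sqrt (2 * pi) * std_normal_density \<xi>)"
proof -
  have "fourier (\<lambda>x. of_real (std_normal_density x)) \<xi> = char std_normal_distribution (- \<xi>)"
    unfolding fourier_real char_def
    by (subst integral_density) (auto simp: scaleR_conv_of_real mult_ac)
  then show ?thesis
    unfolding char_std_normal_distribution by (simp add: std_normal_density_def)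
qed

text \<open>Gaussian regularisation: up to the factor \<open>\<surd>(2\<pi>)\<close>, the standard normal density is its own
  Fourier transform.\<close>

lemma integral_fourier_eq:
  fixes \<kappa> :: "real \<Rightarrow> complex"
  assumes cont: "continuous_on UNIV \<kappa>" and bnd: "\<And>x. norm (\<kappa> x) \<le> B"
    and int: "integrable lborel \<kappa>" and int': "integrable lborel (fourier \<kappa>)"
  shows "(LINT v|lborel. fourier \<kappa> v) = 2 * pi * \<kappa> 0"
proof -
  let ?D = "std_normal_density"
  define \<epsilon> :: "nat \<Rightarrow> real" where "\<epsilon> n = inverse (real (Suc n))" for n
  have \<epsilon>: "\<epsilon> n > 0" for n by (simp add: \<epsilon>_def)
  have \<epsilon>_lim: "\<epsilon> \<longlonglongrightarrow> 0" unfolding \<epsilon>_def[abs_def] by (rule LIMSEQ_inverse_real_of_nat)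
  have D_cont: "continuous_on UNIV ?D"
    unfolding std_normal_density_def[abs_def] by (intro continuous_intros) auto
  have D_isCont: "isCont ?D x" for x
    using D_cont by (simp add: continuous_on_eq_continuous_at)
  have D_le: "\<bar>?D x\<bar> \<le> 1" for x
  proof -
    have "1 \<le> sqrt (2 * pi)" using pi_gt3 by simp
    moreover have "exp (- x\<^sup>2 / 2) \<le> 1" by simp
    ultimately have "exp (- x\<^sup>2 / 2) \<le> sqrt (2 * pi)" by linarith
    then show ?thesis unfolding std_normal_density_def
      using \<open>1 \<le> sqrt (2 * pi)\<close> by (simp add: abs_mult divide_le_eq)
  qed
  have D_int: "integrable lborel ?D" by (rule integrable_normal_density) simp
  have [measurable]: "\<kappa> \<in> borel_measurable borel"
    using cont by (rule borel_measurable_continuous_onI)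
  \<comment> \<open>Multiplication formula: one double integral computed in two orders. Without the
    factor \<open>?D (\<epsilon> n * v)\<close> the modulus of the integrand would not depend on
    \<open>v\<close>, and Fubini would fail.\<close>
  have eq: "(LINT v|lborel. fourier \<kappa> v * of_real (?D (\<epsilon> n * v))) =
      of_real (sqrt (2 * pi)) * (LINT y|lborel. \<kappa> (\<epsilon> n * y) * of_real (?D y))" for n
  proof -
    let ?e = "\<epsilon> n"
    have e: "?e > 0" by (rule \<epsilon>)
    have De_int: "integrable lborel (\<lambda>v. ?D (?e * v))"
      using lborel_integrable_real_affine[OF D_int, of ?e 0] e by simp
    have "(LINT v|lborel. fourier \<kappa> v * of_real (?D (?e * v))) =
      (LINT v|lborel. LINT x|lborel. exp (- (\<i> * of_real (v * x))) * \<kappa> x * of_real (?D (?e * v)))"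
      by (simp add: fourier_real)
    also have "\<dots> = (LINT x|lborel. LINT v|lborel. exp (- (\<i> * of_real (v * x))) * \<kappa> x * of_real (?D (?e * v)))"
      by (rule integral_swap_dominated[where P="\<lambda>v. ?D (?e * v)" and Q="\<lambda>x. norm (\<kappa> x)"])
         (use De_int int in \<open>auto simp: norm_mult case_prod_beta intro!: continuous_intros
            continuous_on_compose2[OF cont] continuous_on_compose2[OF D_cont]\<close>)
    also have "\<dots> = (LINT x|lborel. \<kappa> x * (LINT v|lborel. exp (- (\<i> * of_real (v * x))) * of_real (?D (?e * v))))"
      by (simp flip: integral_mult_right_zero add: mult_ac)
    \<comment> \<open>Dilating a Gaussian by \<open>?e\<close> concentrates its transform at scale
      \<open>?e\<close>; the substitution \<open>x = ?e * y\<close> that follows moves this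
      concentration into the argument of \<open>\<kappa>\<close>.\<close>
    also have "\<dots> = (LINT x|lborel. \<kappa> x * of_real (sqrt (2 * pi) * ?D (x / ?e) / ?e))"
    proof (intro Bochner_Integration.integral_cong refl arg_cong[where f="(*) _"])
      fix x
      have "fourier (\<lambda>v. of_real (?D v)) (x / ?e) =
        ?e *\<^sub>R (LINT v|lborel. exp (- (\<i> * of_real (v * x))) * of_real (?D (?e * v)))"
        unfolding fourier_real using e
        by (subst lborel_integral_real_affine[of ?e _ 0]) (auto simp: mult_ac)
      then show "(LINT v|lborel. exp (- (\<i> * of_real (v * x))) * of_real (?D (?e * v))) =
          of_real (sqrt (2 * pi) * ?D (x / ?e) / ?e)"
        using e by (simp add: fourier_std_normal_density scaleR_conv_of_real field_simps)
    qed
    also have "\<dots> = (LINT y|lborel. \<kappa> (?e * y) * (of_real (sqrt (2 * pi)) * of_real (?D y)))"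
      using e by (subst lborel_integral_real_affine[of ?e _ 0]) (auto simp: scaleR_conv_of_real)
    also have "\<dots> = of_real (sqrt (2 * pi)) * (LINT y|lborel. \<kappa> (?e * y) * of_real (?D y))"
      by (subst integral_mult_right_zero[symmetric]) (simp only: mult.left_commute)
    finally show ?thesis .
  qed
  \<comment> \<open>The regulariser flattens to the constant \<open>?D 0\<close>, dominated by
    \<open>fourier \<kappa>\<close>. On the other side, in \<open>lim2\<close>, the arguments of
    \<open>\<kappa>\<close> collapse to 0, dominated through the bound \<open>B\<close>.\<close>
  have lim1: "(\<lambda>n. LINT v|lborel. fourier \<kappa> v * of_real (?D (\<epsilon> n * v))) \<longlonglongrightarrow>
      (LINT v|lborel. fourier \<kappa> v * of_real (?D 0))"
  proof (rule integral_dominated_convergence[where w="\<lambda>v. norm (fourier \<kappa> v)"])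
    show "AE v in lborel. (\<lambda>n. fourier \<kappa> v * of_real (?D (\<epsilon> n * v))) \<longlonglongrightarrow> fourier \<kappa> v * of_real (?D 0)"
      using \<epsilon>_lim by (intro AE_I2 tendsto_intros isCont_tendsto_compose[OF D_isCont] tendsto_mult_left_zero)
    show "AE v in lborel. norm (fourier \<kappa> v * of_real (?D (\<epsilon> n * v))) \<le> norm (fourier \<kappa> v)" for n
      using D_le by (intro AE_I2) (simp add: norm_mult mult_left_le)
  qed (use int' in auto)
  have lim2: "(\<lambda>n. LINT y|lborel. \<kappa> (\<epsilon> n * y) * of_real (?D y)) \<longlonglongrightarrow>
      (LINT y|lborel. \<kappa> 0 * of_real (?D y))"
  proof (rule integral_dominated_convergence[where w="\<lambda>y. B * ?D y"])
    have "isCont \<kappa> 0" using cont by (simp add: continuous_on_eq_continuous_at)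
    then show "AE v in lborel. (\<lambda>n. \<kappa> (\<epsilon> n * v) * of_real (?D v)) \<longlonglongrightarrow> \<kappa> 0 * of_real (?D v)"
      using \<epsilon>_lim by (intro AE_I2 tendsto_intros isCont_tendsto_compose[of 0 \<kappa>] tendsto_mult_left_zero)
    show "AE v in lborel. norm (\<kappa> (\<epsilon> n * v) * of_real (?D v)) \<le> B * ?D v" for n
      using bnd by (intro AE_I2) (simp add: norm_mult mult_right_mono)
  qed (use D_int in auto)
  have "(LINT v|lborel. fourier \<kappa> v * of_real (?D 0)) =
      of_real (sqrt (2 * pi)) * (LINT y|lborel. \<kappa> 0 * of_real (?D y))"
    using LIMSEQ_unique[OF lim1[unfolded eq] tendsto_mult[OF tendsto_const lim2]] .
  moreover have "(LINT y|lborel. \<kappa> 0 * of_real (?D y)) = \<kappa> 0"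
    by (simp add: integral_complex_of_real)
  ultimately have eq0: "(LINT v|lborel. fourier \<kappa> v) * of_real (?D 0) = of_real (sqrt (2 * pi)) * \<kappa> 0"
    by simp
  let ?s = "sqrt (2 * pi)"
  \<comment> \<open>Dividing by \<open>?D 0\<close> means multiplying by a second
    \<open>sqrt (2 * pi)\<close>; the two roots together give the constant
    \<open>2 * pi\<close>.\<close>
  have D0: "?D 0 * ?s = 1" by (simp add: std_normal_density_def)
  have "(LINT v|lborel. fourier \<kappa> v) = (LINT v|lborel. fourier \<kappa> v) * of_real (?D 0 * ?s)"
    unfolding D0 by simp
  also have "\<dots> = (LINT v|lborel. fourier \<kappa> v) * of_real (?D 0) * of_real ?s"
    by (simp only: of_real_mult mult.assoc)
  also have "\<dots> = of_real (?s * ?s) * \<kappa> 0"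
    unfolding eq0 by (simp only: of_real_mult mult_ac)
  also have "?s * ?s = 2 * pi" by (simp only: real_sqrt_mult_self) simp
  finally show ?thesis by simp
qed

subsection \<open>Schwartz functions on the plane\<close>

lemma iter_partial_append: "iter_partial (bs @ cs) f = iter_partial bs (iter_partial cs f)"
  by (induction bs) simp_all

lemma schwartz_iter_partial:
  assumes "schwartz f" "bs \<in> lists Basis"
  shows "schwartz (iter_partial bs f)"
  using assms unfolding schwartz_def iter_partial_append[symmetric] by simp

lemma schwartz_differentiable: "schwartz f \<Longrightarrow> f differentiable (at x)"
  unfolding schwartz_def by (drule bspec[of _ _ "[]"]) auto

lemma schwartz_continuous: "schwartz f \<Longrightarrow> continuous_on A f"
  by (meson continuous_at_imp_continuous_on differentiable_imp_continuous_within schwartz_differentiable)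

text \<open>The definition controls pure powers of the norm only. As
  \<open>(1 + r\<^sup>2) ^ k\<close> is at most \<open>2 ^ k\<close> times the larger of 1 and
  \<open>r ^ (2 * k)\<close>, the powers 0 and \<open>2 * k\<close> suffice.\<close>

lemma schwartz_bound:
  assumes "schwartz f"
  obtains C where "\<And>x. (1 + (norm x)\<^sup>2) ^ k * norm (f x) \<le> C"
proof -
  have "\<exists>C. \<forall>x. norm x ^ m * norm (f x) \<le> C" for m
    using bspec[OF assms[unfolded schwartz_def], of "[]"] by simp
  then obtain C where C: "\<And>m x. norm x ^ m * norm (f x) \<le> C m"
    by metis
  have "(1 + (norm x)\<^sup>2) ^ k * norm (f x) \<le> 2 ^ k * (C 0 + C (2 * k))" for x
  proof -
    have "(1 + (norm x)\<^sup>2) ^ k \<le> 2 ^ k * (1 + norm x ^ (2 * k))"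
    proof (cases "norm x \<le> 1")
      case True
      then have "1 + (norm x)\<^sup>2 \<le> 2" by (simp add: power_le_one)
      then have "(1 + (norm x)\<^sup>2) ^ k \<le> 2 ^ k" by (intro power_mono) auto
      then show ?thesis by (simp add: distrib_left add_increasing2)
    next
      case False
      then have "1 + (norm x)\<^sup>2 \<le> 2 * (norm x)\<^sup>2"
        using one_le_power[of "norm x" 2] by simp
      then have "(1 + (norm x)\<^sup>2) ^ k \<le> (2 * (norm x)\<^sup>2) ^ k" by (intro power_mono) auto
      then show ?thesis by (simp add: power_mult_distrib power_mult distrib_left add_increasing)
    qed
    then have "(1 + (norm x)\<^sup>2) ^ k * norm (f x) \<le> 2 ^ k * (1 + norm x ^ (2 * k)) * norm (f x)"
      by (rule mult_right_mono) simp
    also have "\<dots> = 2 ^ k * (norm x ^ 0 * norm (f x) + norm x ^ (2 * k) * norm (f x))"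
      by (simp add: algebra_simps)
    also have "\<dots> \<le> 2 ^ k * (C 0 + C (2 * k))"
      by (intro mult_left_mono add_mono C) auto
    finally show ?thesis .
  qed
  then show thesis by (rule that)
qed

lemma schwartz_lorentz_bound:
  fixes f :: "'a::euclidean_space \<Rightarrow> complex"
  assumes "schwartz f"
  obtains C where "0 \<le> C" "\<And>x. norm (f x) \<le> C * lorentz (norm x)"
proof -
  obtain C where C: "\<And>x. (1 + (norm x)\<^sup>2) ^ 1 * norm (f x) \<le> C"
    using schwartz_bound[OF assms, where k=1] by auto
  show thesis
  proof (rule that)
    show "0 \<le> C" using C[of 0] norm_ge_zero[of "f 0"] by (simp del: norm_ge_zero)
    show "norm (f x) \<le> C * lorentz (norm x)" for x
      using C[of x] lorentz_pos[of "norm x"] by (simp add: lorentz_def field_simps)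
  qed
qed

text \<open>The exponent 3 is spent as 2 on \<open>x\<close> and 1 on \<open>y\<close>. The surplus
  factor \<open>lorentz x\<close> pays for the shear \<open>(x, y + t * x)\<close> in
  \<open>integral_fourier_line\<close>.\<close>

lemma schwartz_plane_bound:
  fixes \<phi> :: "real \<times> real \<Rightarrow> complex"
  assumes "schwartz \<phi>"
  obtains C where "0 \<le> C" "\<And>x y. norm (\<phi> (x, y)) \<le> C * (lorentz x)\<^sup>2 * lorentz y"
    "\<And>x y. norm (\<phi> (x, y)) \<le> C * lorentz x * lorentz y"
proof -
  obtain C where C: "\<And>x. (1 + (norm x)\<^sup>2) ^ 3 * norm (\<phi> x) \<le> C"
    using schwartz_bound[OF assms] by blast
  have C0: "0 \<le> C" using C[of 0] norm_ge_zero[of "\<phi> 0"] by (simp del: norm_ge_zero)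
  have *: "norm (\<phi> (x, y)) \<le> C * (lorentz x)\<^sup>2 * lorentz y" for x y
  proof -
    have "(1 + x\<^sup>2)\<^sup>2 * (1 + y\<^sup>2) \<le> (1 + (norm (x, y))\<^sup>2)\<^sup>2 * (1 + (norm (x, y))\<^sup>2)"
      by (intro mult_mono power_mono) (auto simp: norm_Pair)
    also have "\<dots> = (1 + (norm (x, y))\<^sup>2) ^ 3"
      by (simp add: power3_eq_cube power2_eq_square)
    finally have "(1 + x\<^sup>2)\<^sup>2 * (1 + y\<^sup>2) * norm (\<phi> (x, y)) \<le> C"
      using C[of "(x, y)"] by (meson mult_right_mono norm_ge_zero order_trans)
    moreover have "0 < (1 + x\<^sup>2)\<^sup>2 * (1 + y\<^sup>2)" by (intro mult_pos_pos zero_less_power add_pos_nonneg) auto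
    ultimately have "norm (\<phi> (x, y)) \<le> C / ((1 + x\<^sup>2)\<^sup>2 * (1 + y\<^sup>2))"
      by (simp only: pos_le_divide_eq mult.commute)
    then show ?thesis by (simp only: lorentz_def divide_inverse power_inverse inverse_mult_distrib mult.assoc)
  qed
  moreover have "norm (\<phi> (x, y)) \<le> C * lorentz x * lorentz y" for x y
  proof -
    have "C * (lorentz x)\<^sup>2 * lorentz y \<le> C * lorentz x * lorentz y"
      using C0 lorentz_le_1[of x]
      by (intro mult_right_mono mult_left_mono) (auto simp: power2_eq_square mult_left_le)
    with *[of x y] show ?thesis by linarith
  qed
  ultimately show thesis using C0 that by blast
qed

section \<open>Integrability and Fubini under Lorentz bounds\<close>

lemma integrable_continuous_lorentz:
  fixes g :: "real \<Rightarrow> complex"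
  assumes "continuous_on UNIV g" "\<And>x. norm (g x) \<le> C * lorentz x"
  shows "integrable lborel g"
proof -
  have [measurable]: "g \<in> borel_measurable borel"
    using assms(1) by (rule borel_measurable_continuous_onI)
  show ?thesis
    by (rule Bochner_Integration.integrable_bound[OF integrable_mult_right[OF integrable_lorentz, of C]])
       (use assms(2) in \<open>auto intro: order_trans[OF _ abs_ge_self]\<close>)
qed

lemma integrable_plane_lorentz:
  fixes g :: "real \<times> real \<Rightarrow> complex"
  assumes "continuous_on UNIV g" "\<And>x y. norm (g (x, y)) \<le> C * lorentz x * lorentz y"
  shows "integrable lborel g"
  using integrable_dominated_prod[OF assms(1) integrable_mult_right[OF integrable_lorentz, of C]
      integrable_lorentz assms(2)]
  by (simp add: lborel_prod)

lemma integral_swap_lorentz: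
  fixes g :: "real \<Rightarrow> real \<Rightarrow> complex"
  assumes "continuous_on UNIV (\<lambda>(x, y). g x y)" "\<And>x y. norm (g x y) \<le> C * lorentz x * lorentz y"
  shows "(LINT x|lborel. LINT y|lborel. g x y) = (LINT y|lborel. LINT x|lborel. g x y)"
  using integral_swap_dominated[OF assms(1) integrable_mult_right[OF integrable_lorentz, of C]
      integrable_lorentz assms(2)] .

lemma integral_plane_lorentz:
  fixes g :: "real \<times> real \<Rightarrow> complex"
  assumes "continuous_on UNIV g" "\<And>x y. norm (g (x, y)) \<le> C * lorentz x * lorentz y"
  shows "(LINT z|lborel. g z) = (LINT x|lborel. LINT y|lborel. g (x, y))"
  using integral_prod_dominated[OF _ integrable_mult_right[OF integrable_lorentz, of C]
      integrable_lorentz assms(2)] assms(1) by simp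

text \<open>The exponential factors over the coordinates, so Fubini gives both orders. Both are
  recorded because differentiating in a coordinate requires that coordinate to be the inner
  one.\<close>

lemma fourier_plane:
  fixes \<phi> :: "real \<times> real \<Rightarrow> complex"
  assumes cont: "continuous_on UNIV \<phi>" and bnd: "\<And>x y. norm (\<phi> (x, y)) \<le> C * lorentz x * lorentz y"
  shows "fourier \<phi> (u, v) = fourier (\<lambda>x. fourier (\<lambda>y. \<phi> (x, y)) v) u"
    and "fourier \<phi> (u, v) = fourier (\<lambda>y. fourier (\<lambda>x. \<phi> (x, y)) u) v"
proof -
  define G where "G z = exp (- (\<i> * complex_of_real ((u, v) \<bullet> z))) * \<phi> z" for z
  have g: "continuous_on UNIV G" "\<And>x y. norm (G (x, y)) \<le> C * lorentz x * lorentz y"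
    unfolding G_def using bnd by (auto simp: norm_mult simp del: inner_Pair intro!: continuous_intros cont)
  have split: "G (x, y) = exp (- (\<i> * complex_of_real (u * x))) * (exp (- (\<i> * complex_of_real (v * y))) * \<phi> (x, y))" for x y
    by (simp add: G_def exp_add[symmetric] distrib_left)
  show "fourier \<phi> (u, v) = fourier (\<lambda>x. fourier (\<lambda>y. \<phi> (x, y)) v) u"
    unfolding fourier_def[of \<phi>] G_def[symmetric] integral_plane_lorentz[OF g] split by (simp add: fourier_real)
  have "fourier \<phi> (u, v) = (LINT y|lborel. LINT x|lborel. G (x, y))"
    unfolding fourier_def[of \<phi>] G_def[symmetric] integral_plane_lorentz[OF g]
    using g by (intro integral_swap_lorentz) auto
  also have "\<dots> = fourier (\<lambda>y. fourier (\<lambda>x. \<phi> (x, y)) u) v"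
    unfolding split fourier_real integral_mult_right_zero[symmetric] by (simp only: mult.left_commute)
  finally show "fourier \<phi> (u, v) = fourier (\<lambda>y. fourier (\<lambda>x. \<phi> (x, y)) u) v" .
qed

text \<open>Integration by parts: the derivative of \<open>E x * g x\<close> is \<open>G x\<close>,
  and it integrates to 0 over the line because the Lorentz bound on \<open>g\<close> kills both
  boundary terms.\<close>

lemma fourier_derivative:
  fixes g g' :: "real \<Rightarrow> complex"
  assumes deriv: "\<And>x. (g has_vector_derivative g' x) (at x)" and cont: "continuous_on UNIV g'"
    and g: "\<And>x. norm (g x) \<le> C * lorentz x" and g': "\<And>x. norm (g' x) \<le> D * lorentz x"
  shows "fourier g' \<xi> = \<i> * \<xi> * fourier g \<xi>"
proof -
  define E where "E x = exp (- (\<i> * complex_of_real (\<xi> * x)))" for x :: real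
  define G where "G x = E x * g' x - \<i> * \<xi> * (E x * g x)" for x
  have gcont: "continuous_on UNIV g"
    using deriv by (meson continuous_at_imp_continuous_on has_vector_derivative_continuous)
  have Econt: "continuous_on UNIV E" unfolding E_def by (intro continuous_intros)
  have normE: "norm (E x) = 1" for x unfolding E_def by simp
  have E': "(E has_vector_derivative (- (\<i> * \<xi>) * E x)) (at x)" for x
  proof -
    have "((\<lambda>z. exp (- (\<i> * (of_real \<xi> * z)))) has_field_derivative
        (- (\<i> * \<xi>) * exp (- (\<i> * (of_real \<xi> * of_real x))))) (at (of_real x))"
      by (auto intro!: derivative_eq_intros)
    from has_vector_derivative_real_field[OF this] show ?thesis
      by (simp add: E_def[abs_def])
  qed
  have F': "((\<lambda>x. E x * g x) has_vector_derivative G x) (at x)" for x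
    using has_vector_derivative_mult[OF E' deriv, of x]
    by (simp add: G_def algebra_simps)
  have int1: "integrable lborel (\<lambda>x. E x * g' x)"
    using g' by (intro integrable_continuous_lorentz[where C=D] continuous_intros Econt cont)
      (simp add: norm_mult normE)
  have int2: "integrable lborel (\<lambda>x. E x * g x)"
    using g by (intro integrable_continuous_lorentz[where C=C] continuous_intros Econt gcont)
      (simp add: norm_mult normE)
  have intG: "integrable lborel G"
    unfolding G_def by (intro Bochner_Integration.integrable_diff integrable_mult_right int1 int2)
  have contG: "continuous_on UNIV G"
    unfolding G_def by (intro continuous_intros Econt cont gcont)
  have lim: "((\<lambda>x. E x * g x) \<longlongrightarrow> 0) at_infinity"
  proof (rule Lim_null_comparison)
    show "((\<lambda>x. C * lorentz x) \<longlongrightarrow> 0) at_infinity"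
      by (intro tendsto_mult_right_zero lorentz_tendsto_0)
  qed (use g in \<open>auto simp: norm_mult normE\<close>)
  have "(LBINT x=-\<infinity>..\<infinity>. G x) = 0 - 0"
  proof (rule interval_integral_FTC_integrable[where F="\<lambda>x. E x * g x"])
    show "set_integrable lborel (einterval (- \<infinity>) \<infinity>) G"
      using intG by (simp add: set_integrable_def einterval_def)
    show "(((\<lambda>x. E x * g x) \<circ> real_of_ereal) \<longlongrightarrow> 0) (at_right (- \<infinity>))"
      "(((\<lambda>x. E x * g x) \<circ> real_of_ereal) \<longlongrightarrow> 0) (at_left \<infinity>)"
      unfolding ereal_tendsto_simps1
      using lim by (auto simp: at_infinity_eq_at_top_bot filterlim_def filtermap_sup)
  qed (use F' contG in \<open>auto simp: continuous_on_eq_continuous_at\<close>)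
  then have "(LINT x|lborel. G x) = 0"
    by (simp add: interval_lebesgue_integral_def set_lebesgue_integral_def einterval_def)
  then have "(LINT x|lborel. E x * g' x) = \<i> * \<xi> * (LINT x|lborel. E x * g x)"
    unfolding G_def using int1 int2 by simp
  then show ?thesis by (simp add: fourier_real E_def)
qed

lemma fourier_schwartz_partial:
  fixes \<phi> :: "real \<times> real \<Rightarrow> complex"
  assumes \<phi>: "schwartz \<phi>"
  shows "fourier (iter_partial [(1, 0)] \<phi>) (u, v) = \<i> * u * fourier \<phi> (u, v)"
    and "fourier (iter_partial [(0, 1)] \<phi>) (u, v) = \<i> * v * fourier \<phi> (u, v)"
proof -
  obtain C where C: "\<And>x y. norm (\<phi> (x, y)) \<le> C * lorentz x * lorentz y"
    using schwartz_plane_bound[OF \<phi>] by metis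
  have deriv: "(\<phi> has_derivative frechet_derivative \<phi> (at z)) (at z)" for z
    using schwartz_differentiable[OF \<phi>] frechet_derivative_works by blast
  {
    let ?d = "iter_partial [(1, 0)] \<phi>"
    have d: "schwartz ?d" by (rule schwartz_iter_partial[OF \<phi>]) (simp add: Basis_prod_def)
    obtain D where D: "\<And>x y. norm (?d (x, y)) \<le> D * lorentz x * lorentz y"
      using schwartz_plane_bound[OF d] by metis
    have "fourier (\<lambda>x. ?d (x, y)) u = \<i> * u * fourier (\<lambda>x. \<phi> (x, y)) u" for y
    proof (rule fourier_derivative)
      show "((\<lambda>x. \<phi> (x, y)) has_vector_derivative ?d (x, y)) (at x)" for x
      proof -
        have "((\<lambda>x. (x, y)) has_vector_derivative (1, 0)) (at x)"
          by (auto intro!: derivative_eq_intros simp: has_vector_derivative_def)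
        from vector_derivative_diff_chain_within[OF this has_derivative_at_withinI[OF deriv]]
        show ?thesis by (simp add: comp_def)
      qed
      show "continuous_on UNIV (\<lambda>x. ?d (x, y))"
        by (rule continuous_on_compose2[OF schwartz_continuous[OF d, of UNIV]]) (auto intro!: continuous_intros)
      show "norm (\<phi> (x, y)) \<le> C * lorentz y * lorentz x" "norm (?d (x, y)) \<le> D * lorentz y * lorentz x" for x
        using C[of x y] D[of x y] by (simp_all add: mult_ac)
    qed
    then show "fourier ?d (u, v) = \<i> * u * fourier \<phi> (u, v)"
      unfolding fourier_plane(2)[OF schwartz_continuous[OF \<phi>] C] fourier_plane(2)[OF schwartz_continuous[OF d] D]
      by (simp add: fourier_real mult.left_commute)
  }
  {
    let ?d = "iter_partial [(0, 1)] \<phi>"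
    have d: "schwartz ?d" by (rule schwartz_iter_partial[OF \<phi>]) (simp add: Basis_prod_def)
    obtain D where D: "\<And>x y. norm (?d (x, y)) \<le> D * lorentz x * lorentz y"
      using schwartz_plane_bound[OF d] by metis
    have "fourier (\<lambda>y. ?d (x, y)) v = \<i> * v * fourier (\<lambda>y. \<phi> (x, y)) v" for x
    proof (rule fourier_derivative)
      show "((\<lambda>y. \<phi> (x, y)) has_vector_derivative ?d (x, y)) (at y)" for y
      proof -
        have "((\<lambda>y. (x, y)) has_vector_derivative (0, 1)) (at y)"
          by (auto intro!: derivative_eq_intros simp: has_vector_derivative_def)
        from vector_derivative_diff_chain_within[OF this has_derivative_at_withinI[OF deriv]]
        show ?thesis by (simp add: comp_def)
      qed
      show "continuous_on UNIV (\<lambda>y. ?d (x, y))"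
        by (rule continuous_on_compose2[OF schwartz_continuous[OF d, of UNIV]]) (auto intro!: continuous_intros)
    qed (use C D in auto)
    then show "fourier ?d (u, v) = \<i> * v * fourier \<phi> (u, v)"
      unfolding fourier_plane(1)[OF schwartz_continuous[OF \<phi>] C] fourier_plane(1)[OF schwartz_continuous[OF d] D]
      by (simp add: fourier_real mult.left_commute)
  }
qed

lemma schwartz_integrable_plane:
  fixes \<phi> :: "real \<times> real \<Rightarrow> complex"
  assumes "schwartz \<phi>"
  shows "integrable lborel \<phi>"
  using schwartz_plane_bound[OF assms] integrable_plane_lorentz[OF schwartz_continuous[OF assms]] by metis

text \<open>Up to sign, multiplying the transform by \<open>u\<^sup>2\<close>,
  \<open>v\<^sup>2\<close> or \<open>u\<^sup>2 * v\<^sup>2\<close> gives the transform of a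
  derivative of \<open>\<phi>\<close>, which is bounded by an L1 norm. Adding these bounds to that
  of the transform itself produces the factor
  \<open>(1 + u\<^sup>2) * (1 + v\<^sup>2)\<close>.\<close>

lemma fourier_schwartz_plane_bound:
  fixes \<phi> :: "real \<times> real \<Rightarrow> complex"
  assumes \<phi>: "schwartz \<phi>"
  obtains C where "0 \<le> C" "\<And>u v. norm (fourier \<phi> (u, v)) \<le> C * lorentz u * lorentz v"
proof -
  let ?b1 = "(1, 0) :: real \<times> real" and ?b2 = "(0, 1) :: real \<times> real"
  let ?x = "iter_partial [?b1] (iter_partial [?b1] \<phi>)"
  let ?y = "iter_partial [?b2] (iter_partial [?b2] \<phi>)"
  let ?xy = "iter_partial [?b2] (iter_partial [?b2] ?x)"
  have b: "[?b1] \<in> lists Basis" "[?b2] \<in> lists Basis" by (auto simp: Basis_prod_def)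
  have x1: "schwartz (iter_partial [?b1] \<phi>)" and y1: "schwartz (iter_partial [?b2] \<phi>)"
    using schwartz_iter_partial \<phi> b by blast+
  have x: "schwartz ?x" using schwartz_iter_partial x1 b by blast
  have xy1: "schwartz (iter_partial [?b2] ?x)" using schwartz_iter_partial x b by blast
  let ?N = "\<lambda>\<psi>. LINT z|lborel. norm (\<psi> z :: complex)"
  let ?C = "?N \<phi> + ?N ?x + ?N ?y + ?N ?xy"
  have N: "norm (fourier \<psi> w) \<le> ?N \<psi>" for \<psi> :: "real \<times> real \<Rightarrow> complex" and w
    by (rule norm_fourier_le)
  note fp = fourier_schwartz_partial
  have "norm (fourier \<phi> (u, v)) \<le> ?C * lorentz u * lorentz v" for u v
  proof -
    let ?f = "norm (fourier \<phi> (u, v))"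
    have "u\<^sup>2 * ?f \<le> ?N ?x"
      using N[of "?x" "(u, v)"] unfolding fp(1)[OF x1] fp(1)[OF \<phi>]
      by (simp add: norm_mult power2_eq_square mult.assoc[symmetric])
    moreover have "v\<^sup>2 * ?f \<le> ?N ?y"
      using N[of "?y" "(u, v)"] unfolding fp(2)[OF y1] fp(2)[OF \<phi>]
      by (simp add: norm_mult power2_eq_square mult.assoc[symmetric])
    moreover have "v\<^sup>2 * u\<^sup>2 * ?f \<le> ?N ?xy"
      using N[of "?xy" "(u, v)"] unfolding fp(2)[OF xy1] fp(2)[OF x] fp(1)[OF x1] fp(1)[OF \<phi>]
      by (simp add: norm_mult power2_eq_square mult.assoc[symmetric])
    moreover have "?f \<le> ?N \<phi>" by (rule N)
    moreover have "(1 + u\<^sup>2) * (1 + v\<^sup>2) * ?f = ?f + u\<^sup>2 * ?f + v\<^sup>2 * ?f + v\<^sup>2 * u\<^sup>2 * ?f"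
      by (simp add: algebra_simps)
    ultimately have "(1 + u\<^sup>2) * (1 + v\<^sup>2) * ?f \<le> ?C" by linarith
    moreover have "0 < (1 + u\<^sup>2) * (1 + v\<^sup>2)" by (intro mult_pos_pos zero_less_power add_pos_nonneg) auto
    ultimately have "?f \<le> ?C / ((1 + u\<^sup>2) * (1 + v\<^sup>2))"
      by (simp only: pos_le_divide_eq mult.commute)
    then show ?thesis by (simp only: lorentz_def divide_inverse inverse_mult_distrib mult.assoc)
  qed
  moreover have "0 \<le> ?C" by simp
  ultimately show thesis using that by blast
qed

subsection \<open>Uniqueness of Fourier values\<close>

lemma real_polynomial_function_has_derivative:
  fixes p :: "'a::real_normed_vector \<Rightarrow> real"
  assumes "real_polynomial_function p"
  shows "\<exists>p'. (\<forall>x. (p has_derivative p' x) (at x)) \<and> (\<forall>b. real_polynomial_function (\<lambda>x. p' x b))"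
  using assms
proof induction
  case (linear f)
  then show ?case
    by (intro exI[of _ "\<lambda>_. f"]) (auto intro: bounded_linear_imp_has_derivative)
next
  case (const c)
  show ?case by (intro exI[of _ "\<lambda>_ _. 0"]) auto
next
  case (add f g)
  then obtain f' g' where "\<And>x. (f has_derivative f' x) (at x)" "\<And>b. real_polynomial_function (\<lambda>x. f' x b)"
    "\<And>x. (g has_derivative g' x) (at x)" "\<And>b. real_polynomial_function (\<lambda>x. g' x b)"
    by blast
  then show ?case
    by (intro exI[of _ "\<lambda>x b. f' x b + g' x b"]) (auto intro!: derivative_intros)
next
  case (mult f g)
  then obtain f' g' where "\<And>x. (f has_derivative f' x) (at x)" "\<And>b. real_polynomial_function (\<lambda>x. f' x b)"
    "\<And>x. (g has_derivative g' x) (at x)" "\<And>b. real_polynomial_function (\<lambda>x. g' x b)"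
    by blast
  then show ?case using mult.hyps
    by (intro exI[of _ "\<lambda>x b. f x * g' x b + f' x b * g x"]) (intro conjI allI has_derivative_mult real_polynomial_function.intros(3,4); simp)
qed

lemma real_polynomial_function_growth:
  fixes p :: "'a::real_normed_vector \<Rightarrow> real"
  assumes "real_polynomial_function p"
  shows "\<exists>C m. 0 \<le> C \<and> (\<forall>x. \<bar>p x\<bar> \<le> C * (1 + norm x) ^ m)"
  using assms
proof induction
  case (linear f)
  then obtain K where K: "0 \<le> K" "\<And>x. norm (f x) \<le> norm x * K"
    using bounded_linear.nonneg_bounded by blast
  have "\<bar>f x\<bar> \<le> K * (1 + norm x) ^ 1" for x
    using K(2)[of x] K(1) by (simp add: distrib_left mult.commute)
  with K(1) show ?case by blast
next
  case (const c)
  have "\<bar>c\<bar> \<le> \<bar>c\<bar> * (1 + norm x) ^ 0" for x :: 'a by simp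
  then show ?case using abs_ge_zero by blast
next
  case (add f g)
  then obtain C m D n where f: "0 \<le> C" "\<And>x. \<bar>f x\<bar> \<le> C * (1 + norm x) ^ m"
    and g: "0 \<le> D" "\<And>x. \<bar>g x\<bar> \<le> D * (1 + norm x) ^ n" by blast
  have "\<bar>f x + g x\<bar> \<le> (C + D) * (1 + norm x) ^ (m + n)" for x
  proof -
    have "C * (1 + norm x) ^ m \<le> C * (1 + norm x) ^ (m + n)" "D * (1 + norm x) ^ n \<le> D * (1 + norm x) ^ (m + n)"
      using f(1) g(1) by (auto intro!: mult_left_mono power_increasing)
    then show ?thesis using f(2)[of x] g(2)[of x] by (simp add: distrib_right)
  qed
  moreover have "0 \<le> C + D" using f(1) g(1) by simp
  ultimately show ?case by blast
next
  case (mult f g)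
  then obtain C m D n where f: "0 \<le> C" "\<And>x. \<bar>f x\<bar> \<le> C * (1 + norm x) ^ m"
    and g: "0 \<le> D" "\<And>x. \<bar>g x\<bar> \<le> D * (1 + norm x) ^ n" by blast
  have "\<bar>f x * g x\<bar> \<le> (C * D) * (1 + norm x) ^ (m + n)" for x
    using mult_mono[OF f(2) g(2), of x x] f(1) by (simp add: abs_mult power_add mult_ac)
  moreover have "0 \<le> C * D" using f(1) g(1) by simp
  ultimately show ?case by blast
qed

definition gaussian :: "real \<Rightarrow> 'a::euclidean_space \<Rightarrow> 'a \<Rightarrow> real" where
  "gaussian c \<xi> x = exp (- (c * ((x - \<xi>) \<bullet> (x - \<xi>))))"

lemma gaussian_pos: "0 < gaussian c \<xi> x" by (simp add: gaussian_def)

text \<open>With \<open>r = norm (x - \<xi>)\<close>, one has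
  \<open>1 + norm x \<le> (1 + norm \<xi>) * exp r\<close>, so the polynomial part grows at most
  like \<open>exp (n * r)\<close>, which \<open>exp (- c * r\<^sup>2)\<close> outweighs.\<close>

lemma polynomial_gaussian_bounded:
  fixes \<xi> :: "'a::euclidean_space"
  assumes "real_polynomial_function p" "0 < c"
  shows "\<exists>C. \<forall>x. norm x ^ k * \<bar>p x * gaussian c \<xi> x\<bar> \<le> C"
proof -
  obtain C m where C: "0 \<le> C" "\<And>x. \<bar>p x\<bar> \<le> C * (1 + norm x) ^ m"
    using real_polynomial_function_growth[OF assms(1)] by blast
  let ?n = "k + m"
  have "norm x ^ k * \<bar>p x * gaussian c \<xi> x\<bar> \<le> C * (1 + norm \<xi>) ^ ?n * exp (real ?n ^ 2 / (4 * c))" for x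
  proof -
    define r where "r = norm (x - \<xi>)"
    have "norm x ^ k * \<bar>p x\<bar> \<le> (1 + norm x) ^ k * (C * (1 + norm x) ^ m)"
      by (intro mult_mono power_mono C) auto
    also have "\<dots> = C * (1 + norm x) ^ ?n" by (simp add: power_add)
    also have "\<dots> \<le> C * ((1 + norm \<xi>) * exp r) ^ ?n"
    proof (intro mult_left_mono power_mono C)
      have "1 + norm x \<le> 1 + norm \<xi> + r"
        unfolding r_def using norm_triangle_sub[of x \<xi>] by simp
      also have "\<dots> \<le> (1 + norm \<xi>) * (1 + r)"
        unfolding r_def by (simp add: algebra_simps)
      also have "\<dots> \<le> (1 + norm \<xi>) * exp r"
        by (intro mult_left_mono exp_ge_add_one_self) auto
      finally show "1 + norm x \<le> (1 + norm \<xi>) * exp r" .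
    qed auto
    finally have 1: "norm x ^ k * \<bar>p x\<bar> \<le> C * (1 + norm \<xi>) ^ ?n * exp (real ?n * r)"
      by (simp add: power_mult_distrib exp_of_nat_mult mult.assoc del: of_nat_add)
    \<comment> \<open>Completing the square; the maximum over \<open>r\<close> is at
      \<open>r = n / (2 * c)\<close>.\<close>
    have "real ?n * r - c * r\<^sup>2 \<le> real ?n ^ 2 / (4 * c)"
      using zero_le_power2[of "2 * c * r - real ?n"] assms(2)
      by (simp add: field_simps power2_eq_square)
    then have "exp (real ?n * r) * exp (- (c * r\<^sup>2)) \<le> exp (real ?n ^ 2 / (4 * c))"
      by (simp add: exp_add[symmetric])
    then have 2: "exp (real ?n * r) * gaussian c \<xi> x \<le> exp (real ?n ^ 2 / (4 * c))"
      by (simp add: gaussian_def r_def power2_norm_eq_inner)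
    have "norm x ^ k * \<bar>p x * gaussian c \<xi> x\<bar> = norm x ^ k * \<bar>p x\<bar> * gaussian c \<xi> x"
      using gaussian_pos[of c \<xi> x] by (simp add: abs_mult)
    also have "\<dots> \<le> C * (1 + norm \<xi>) ^ ?n * exp (real ?n * r) * gaussian c \<xi> x"
      using gaussian_pos[of c \<xi> x] by (intro mult_right_mono 1) auto
    also have "\<dots> \<le> C * (1 + norm \<xi>) ^ ?n * exp (real ?n ^ 2 / (4 * c))"
      unfolding mult.assoc[of _ "exp _" "gaussian _ _ _"] using C(1) by (intro mult_left_mono 2) auto
    finally show ?thesis .
  qed
  then show ?thesis by blast
qed

lemma has_derivative_polynomial_gaussian:
  fixes \<xi> :: "'a::euclidean_space"
  assumes "(p has_derivative p') (at x)"
  shows "((\<lambda>x. complex_of_real (p x * gaussian c \<xi> x)) has_derivative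
    (\<lambda>b. of_real ((p' b - 2 * c * ((x - \<xi>) \<bullet> b) * p x) * gaussian c \<xi> x))) (at x)"
  unfolding gaussian_def
  by (rule derivative_eq_intros assms refl)+ (auto simp: fun_eq_iff inner_commute algebra_simps)

text \<open>Polynomial times Gaussian is the shape preserved by each derivative: the product rule
  replaces \<open>p\<close> by the polynomial \<open>?q\<close>.\<close>

lemma iter_partial_gaussian:
  fixes \<xi> :: "'a::euclidean_space"
  shows "\<exists>p. real_polynomial_function p \<and>
    iter_partial bs (\<lambda>x. complex_of_real (gaussian c \<xi> x)) = (\<lambda>x. of_real (p x * gaussian c \<xi> x))"
proof (induction bs)
  case Nil
  show ?case by (intro exI[of _ "\<lambda>_. 1"]) auto
next
  case (Cons b bs)
  then obtain p where p: "real_polynomial_function p"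
    and eq: "iter_partial bs (\<lambda>x. complex_of_real (gaussian c \<xi> x)) = (\<lambda>x. of_real (p x * gaussian c \<xi> x))"
    by blast
  obtain p' where p': "\<And>x. (p has_derivative p' x) (at x)" "real_polynomial_function (\<lambda>x. p' x b)"
    using real_polynomial_function_has_derivative[OF p] by blast
  let ?q = "\<lambda>x. p' x b - 2 * c * ((x - \<xi>) \<bullet> b) * p x"
  have "real_polynomial_function (\<lambda>x. x \<bullet> b)"
    by (intro real_polynomial_function.intros(1) bounded_linear_inner_left)
  then have "real_polynomial_function ?q"
    unfolding inner_diff_left using p p'(2)
    by (intro real_polynomial_function_diff real_polynomial_function.intros(2,4))
  moreover have "iter_partial (b # bs) (\<lambda>x. complex_of_real (gaussian c \<xi> x)) = (\<lambda>x. of_real (?q x * gaussian c \<xi> x))"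
  proof
    fix x
    show "iter_partial (b # bs) (\<lambda>x. complex_of_real (gaussian c \<xi> x)) x = of_real (?q x * gaussian c \<xi> x)"
      unfolding iter_partial.simps eq
        frechet_derivative_at[OF has_derivative_polynomial_gaussian[OF p'(1)[of x]], symmetric] ..
  qed
  ultimately show ?case by blast
qed

lemma schwartz_gaussian:
  fixes \<xi> :: "'a::euclidean_space"
  assumes "0 < c"
  shows "schwartz (\<lambda>x. complex_of_real (gaussian c \<xi> x))"
  unfolding schwartz_def
proof (intro ballI)
  fix bs :: "'a list"
  obtain p where p: "real_polynomial_function p"
    and eq: "iter_partial bs (\<lambda>x. complex_of_real (gaussian c \<xi> x)) = (\<lambda>x. of_real (p x * gaussian c \<xi> x))"
    using iter_partial_gaussian by blast
  obtain p' where p': "\<And>x. (p has_derivative p' x) (at x)"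
    using real_polynomial_function_has_derivative[OF p] by blast
  show "(\<forall>x. iter_partial bs (\<lambda>x. complex_of_real (gaussian c \<xi> x)) differentiable at x) \<and>
    (\<forall>k. \<exists>C. \<forall>x. norm x ^ k * norm (iter_partial bs (\<lambda>x. complex_of_real (gaussian c \<xi> x)) x) \<le> C)"
    unfolding eq norm_of_real
    using has_derivative_polynomial_gaussian[OF p'] polynomial_gaussian_bounded[OF p assms]
    by (auto simp only: differentiable_def real_norm_def)
qed

text \<open>If the difference \<open>D\<close> of two representatives did not vanish at \<open>\<xi>\<close>, then \<open>Re (cnj d * D)\<close> would
  be positive on a \<open>\<delta>\<close>-ball about \<open>\<xi>\<close>. Testing against \<open>exp (-c |x - \<xi>|\<^sup>2)\<close>, the half ball contributes
  at least \<open>A exp (-c \<delta>\<^sup>2/4)\<close>, while the complement of the ball contributes at most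
  \<open>M exp (-(c - 1) \<delta>\<^sup>2)\<close>, a contradiction for large \<open>c\<close>.\<close>

lemma represents_fourier_unique_value:
  fixes \<xi> :: "'a::euclidean_space"
  assumes G1: "represents_fourier F G1" "isCont G1 \<xi>" and G2: "represents_fourier F G2" "isCont G2 \<xi>"
  shows "G1 \<xi> = G2 \<xi>"
proof (rule ccontr)
  assume ne: "G1 \<xi> \<noteq> G2 \<xi>"
  define D where "D x = G1 x - G2 x" for x
  define d where "d = D \<xi>"
  have d: "0 < norm d" using ne by (simp add: d_def D_def)
  have D_int: "integrable lborel (\<lambda>x. D x * of_real (gaussian c \<xi> x))"
    and D_zero: "(LINT x|lborel. D x * of_real (gaussian c \<xi> x)) = 0" if "0 < c" for c
  proof -
    have "integrable lborel (\<lambda>x. G1 x * of_real (gaussian c \<xi> x))"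
      "integrable lborel (\<lambda>x. G2 x * of_real (gaussian c \<xi> x))"
      "(LINT x|lborel. G1 x * of_real (gaussian c \<xi> x)) = (LINT x|lborel. G2 x * of_real (gaussian c \<xi> x))"
      using G1(1) G2(1) schwartz_gaussian[OF that, of \<xi>] unfolding represents_fourier_def by auto
    then show "integrable lborel (\<lambda>x. D x * of_real (gaussian c \<xi> x))"
      "(LINT x|lborel. D x * of_real (gaussian c \<xi> x)) = 0"
      by (auto simp: D_def left_diff_distrib)
  qed
  have "isCont (\<lambda>x. Re (cnj d * D x)) \<xi>"
    unfolding D_def using G1(2) G2(2) by (intro isCont_Re continuous_intros)
  moreover have "Re (cnj d * D \<xi>) = (norm d)\<^sup>2"
    unfolding d_def[symmetric] by (metis Re_complex_of_real complex_norm_square mult.commute of_real_power)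
  ultimately have "((\<lambda>x. Re (cnj d * D x)) \<longlongrightarrow> (norm d)\<^sup>2) (at \<xi>)"
    by (simp add: isCont_def)
  moreover have "(norm d)\<^sup>2 / 2 < (norm d)\<^sup>2" using d by simp
  ultimately have "eventually (\<lambda>x. (norm d)\<^sup>2 / 2 < Re (cnj d * D x)) (at \<xi>)"
    by (rule order_tendstoD(1))
  then obtain \<delta> where \<delta>: "0 < \<delta>" and near: "\<And>x. x \<noteq> \<xi> \<Longrightarrow> dist x \<xi> < \<delta> \<Longrightarrow> (norm d)\<^sup>2 / 2 < Re (cnj d * D x)"
    unfolding eventually_at by blast
  have near: "(norm d)\<^sup>2 / 2 \<le> Re (cnj d * D x)" if "dist x \<xi> < \<delta>" for x
    using near[OF _ that] \<open>Re (cnj d * D \<xi>) = (norm d)\<^sup>2\<close> by (cases "x = \<xi>") auto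
  define A where "A = (norm d)\<^sup>2 / 2 * measure lborel (ball \<xi> (\<delta> / 2))"
  \<comment> \<open>\<open>D\<close> itself need not be integrable, but its product with the
    Gaussian of parameter 1 is. One unit of \<open>c\<close> is reserved for this fixed weight, and
    the remaining \<open>c - 1\<close> gives the decay outside the ball.\<close>
  define M where "M = norm d * (LINT x|lborel. norm (D x * of_real (gaussian 1 \<xi> x)))"
  have A: "0 < A"
    unfolding A_def using d \<delta> by (simp add: content_ball_pos)
  have key: "A * exp (- (c * \<delta>\<^sup>2 / 4)) \<le> M * exp (- ((c - 1) * \<delta>\<^sup>2))" if c: "1 \<le> c" for c
  proof -
    let ?low = "\<lambda>x. (norm d)\<^sup>2 / 2 * exp (- (c * \<delta>\<^sup>2 / 4)) * indicator (ball \<xi> (\<delta> / 2)) x"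
    let ?far = "\<lambda>x. exp (- ((c - 1) * \<delta>\<^sup>2)) * norm d * norm (D x * of_real (gaussian 1 \<xi> x))"
    have low_int: "integrable lborel ?low"
      by (intro integrable_mult_right integrable_real_indicator) (use emeasure_lborel_ball_finite[of \<xi> "\<delta> / 2"] in auto)
    have far_int: "integrable lborel ?far"
      by (intro integrable_mult_right integrable_norm D_int) auto
    have Re_int: "integrable lborel (\<lambda>x. Re (cnj d * (D x * of_real (gaussian c \<xi> x))))"
      using D_int[of c] c by (intro integrable_Re integrable_mult_right) auto
    \<comment> \<open>Three zones: the half ball gives the gain \<open>?low\<close>, in the annulus
      up to \<open>\<delta>\<close> the sign of the integrand is enough, and beyond
      \<open>\<delta>\<close> the loss is at most \<open>?far\<close>.\<close>
    have "?low x - ?far x \<le> Re (cnj d * (D x * of_real (gaussian c \<xi> x)))" for x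
    proof -
      have Re_eq: "Re (cnj d * (D x * of_real (gaussian c \<xi> x))) = Re (cnj d * D x) * gaussian c \<xi> x"
        by (simp add: algebra_simps)
      have far_nonneg: "0 \<le> ?far x" by simp
      have g: "gaussian c \<xi> x = exp (- (c * (dist x \<xi>)\<^sup>2))" for c
        by (simp add: gaussian_def dist_norm power2_norm_eq_inner)
      consider "dist x \<xi> < \<delta> / 2" | "\<delta> / 2 \<le> dist x \<xi>" "dist x \<xi> < \<delta>" | "\<delta> \<le> dist x \<xi>" by linarith
      then show ?thesis
      proof cases
        case 1
        then have "(dist x \<xi>)\<^sup>2 \<le> (\<delta> / 2)\<^sup>2" by (intro power_mono) auto
        then have g_ge: "exp (- (c * \<delta>\<^sup>2 / 4)) \<le> gaussian c \<xi> x"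
          unfolding g using c by (simp add: power_divide mult_left_mono)
        have r: "(norm d)\<^sup>2 / 2 \<le> Re (cnj d * D x)" using 1 \<delta> by (intro near) linarith
        have "0 \<le> Re (cnj d * D x)" by (rule order_trans[OF _ r]) simp
        then have "(norm d)\<^sup>2 / 2 * exp (- (c * \<delta>\<^sup>2 / 4)) \<le> Re (cnj d * D x) * gaussian c \<xi> x"
          by (intro mult_mono r g_ge) simp_all
        moreover have "?low x = (norm d)\<^sup>2 / 2 * exp (- (c * \<delta>\<^sup>2 / 4))"
          using 1 by (simp add: dist_commute)
        ultimately show ?thesis unfolding Re_eq using far_nonneg by linarith
      next
        case 2
        have "0 \<le> Re (cnj d * D x)" by (rule order_trans[OF _ near[OF 2(2)]]) simp
        then have "0 \<le> Re (cnj d * D x) * gaussian c \<xi> x"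
          using gaussian_pos[of c \<xi> x] by (intro mult_nonneg_nonneg) auto
        moreover have "?low x = 0" using 2 by (simp add: dist_commute)
        ultimately show ?thesis unfolding Re_eq using far_nonneg by linarith
      next
        case 3
        have "gaussian c \<xi> x = exp (- ((c - 1) * (dist x \<xi>)\<^sup>2)) * gaussian 1 \<xi> x"
          unfolding g by (simp add: exp_add[symmetric] algebra_simps)
        also have "\<dots> \<le> exp (- ((c - 1) * \<delta>\<^sup>2)) * gaussian 1 \<xi> x"
          using 3 \<delta> c gaussian_pos[of 1 \<xi> x]
          by (intro mult_right_mono) (auto intro!: mult_left_mono power_mono)
        finally have gle: "gaussian c \<xi> x \<le> exp (- ((c - 1) * \<delta>\<^sup>2)) * gaussian 1 \<xi> x" .
        have "- Re (cnj d * D x) \<le> norm d * norm (D x)"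
          using abs_Re_le_cmod[of "cnj d * D x"] by (simp add: norm_mult del: times_complex.sel)
        then have "- Re (cnj d * D x) * gaussian c \<xi> x \<le> norm d * norm (D x) * gaussian c \<xi> x"
          using gaussian_pos[of c \<xi> x] by (intro mult_right_mono) auto
        also have "\<dots> \<le> norm d * norm (D x) * (exp (- ((c - 1) * \<delta>\<^sup>2)) * gaussian 1 \<xi> x)"
          by (intro mult_left_mono gle) auto
        also have "\<dots> = ?far x"
          using gaussian_pos[of 1 \<xi> x] by (simp add: norm_mult mult_ac)
        finally have "- ?far x \<le> Re (cnj d * D x) * gaussian c \<xi> x" by linarith
        moreover have "?low x = 0" using 3 \<delta> by (simp add: dist_commute)
        ultimately show ?thesis unfolding Re_eq by linarith
      qed
    qed
    then have "(LINT x|lborel. ?low x - ?far x) \<le> (LINT x|lborel. Re (cnj d * (D x * of_real (gaussian c \<xi> x))))"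
      by (intro integral_mono Bochner_Integration.integrable_diff low_int far_int Re_int)
    also have "\<dots> = 0"
      using D_zero[of c] D_int[of c] c by (subst integral_Re) auto
    finally have "integral\<^sup>L lborel ?low \<le> integral\<^sup>L lborel ?far"
      using low_int far_int by simp
    then show ?thesis by (simp add: A_def M_def mult_ac)
  qed
  have M: "0 \<le> M" unfolding M_def by simp
  \<comment> \<open>The solution of \<open>(c - 1) * \<delta>\<^sup>2 = c * \<delta>\<^sup>2 / 4 + M
    / A\<close>. With it \<open>key\<close> becomes \<open>exp (M / A) \<le> M / A\<close>,
    contradicting \<open>1 + x \<le> exp x\<close>.\<close>
  define c where "c = 4 / 3 + 4 / 3 * (M / A) / \<delta>\<^sup>2"
  have c: "1 \<le> c" unfolding c_def using M A \<delta> by (simp add: add_increasing2)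
  have eq: "(c - 1) * \<delta>\<^sup>2 = c * \<delta>\<^sup>2 / 4 + M / A"
    unfolding c_def using \<delta> by (simp add: field_simps)
  have "A * exp (- (c * \<delta>\<^sup>2 / 4)) \<le> M * exp (- (M / A)) * exp (- (c * \<delta>\<^sup>2 / 4))"
    using key[OF c] unfolding eq by (simp add: mult.assoc exp_add[symmetric] add.commute)
  then have "A \<le> M * exp (- (M / A))" by simp
  then have "exp (M / A) \<le> M / A"
    using A by (simp add: exp_minus field_simps)
  then show False using exp_ge_add_one_self[of "M / A"] by linarith
qed

lemma fourier_distr_eqI:
  assumes "represents_fourier F G" "isCont G \<xi>"
  shows "fourier_distr F \<xi> = G \<xi>"
  unfolding fourier_distr_def has_fourier_value_def
  using assms represents_fourier_unique_value by (intro the_equality) blast+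

subsection \<open>The ray transform\<close>

lemma continuous_integral_lorentz:
  fixes g :: "'a::metric_space \<Rightarrow> real \<Rightarrow> complex"
  assumes cont: "continuous_on UNIV (\<lambda>(z, x). g z x)" and bnd: "\<And>z x. norm (g z x) \<le> C * lorentz x"
  shows "continuous_on UNIV (\<lambda>z. LINT x|lborel. g z x)"
  unfolding continuous_on_eq_continuous_at[OF open_UNIV]
proof (intro ballI isCont_integral_dominated[where w="\<lambda>x. C * lorentz x"])
  show "g z \<in> borel_measurable lborel" for z
    using continuous_on_compose2[OF cont, of UNIV "\<lambda>x. (z, x)"]
    by (simp add: borel_measurable_continuous_onI continuous_on_Pair)
  show "isCont (\<lambda>z. g z x) z" for x z
    using continuous_on_compose2[OF cont, of UNIV "\<lambda>z. (z, x)"]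
    by (simp add: continuous_on_Pair continuous_on_eq_continuous_at)
qed (use bnd integrable_lorentz in auto)

text \<open>A non-integrable \<open>g\<close> has integral 0 by convention, so the estimate covers
  that case as well.\<close>

lemma norm_integral_lorentz_le:
  fixes g :: "real \<Rightarrow> complex"
  assumes "\<And>x. norm (g x) \<le> C * lorentz x"
  shows "norm (LINT x|lborel. g x) \<le> C * integral\<^sup>L lborel lorentz"
proof -
  have "norm (LINT x|lborel. g x) \<le> (LINT x|lborel. norm (g x))"
    by (rule integral_norm_bound)
  also have "\<dots> \<le> (LINT x|lborel. C * lorentz x)"
    using assms order_trans[OF norm_ge_zero assms]
    by (intro integral_mono' integrable_mult_right integrable_lorentz) auto
  finally show ?thesis by simp
qed

lemma fourier_translate:
  fixes g :: "real \<Rightarrow> complex"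
  shows "fourier (\<lambda>x. g (x + a)) v = exp (\<i> * of_real (v * a)) * fourier g v"
proof -
  have "fourier g v = (LINT x|lborel. exp (- (\<i> * of_real (v * (a + x)))) * g (a + x))"
    unfolding fourier_real by (subst lborel_integral_real_affine[of 1 _ a]) auto
  also have "\<dots> = exp (- (\<i> * of_real (v * a))) * fourier (\<lambda>x. g (x + a)) v"
    unfolding fourier_real integral_mult_right_zero[symmetric]
    by (simp add: exp_add[symmetric] algebra_simps)
  finally show ?thesis by (simp add: exp_minus)
qed

text \<open>For fixed \<open>w\<close> and \<open>t\<close>, \<open>v \<mapsto> \<phi>\<^sup>\<and>(w - tv, v)\<close> is the one-dimensional Fourier transform of
  \<open>\<eta> \<mapsto> \<integral> exp (-iw\<sigma>) \<phi>(\<sigma>, \<eta> + t\<sigma>) d\<sigma>\<close>, so inversion at the origin applies.\<close>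

lemma integral_fourier_line:
  fixes \<phi> :: "real \<times> real \<Rightarrow> complex"
  assumes \<phi>: "schwartz \<phi>"
  shows "(LINT v|lborel. fourier \<phi> (w - t * v, v)) =
    2 * pi * (LINT \<sigma>|lborel. exp (- (\<i> * of_real (w * \<sigma>))) * \<phi> (\<sigma>, t * \<sigma>))"
proof -
  obtain C where C: "0 \<le> C" "\<And>x y. norm (\<phi> (x, y)) \<le> C * (lorentz x)\<^sup>2 * lorentz y"
    "\<And>x y. norm (\<phi> (x, y)) \<le> C * lorentz x * lorentz y"
    by (rule schwartz_plane_bound[OF \<phi>]) (rule that)
  obtain B where B: "0 \<le> B" "\<And>u v. norm (fourier \<phi> (u, v)) \<le> B * lorentz u * lorentz v"
    by (rule fourier_schwartz_plane_bound[OF \<phi>]) (rule that)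
  note cont = schwartz_continuous[OF \<phi>, of UNIV]
  \<comment> \<open>Modulation by \<open>w\<close> and the shear by \<open>t\<close> are chosen so
    that the phases combine to the frequency \<open>w - t * v\<close> in \<open>\<sigma>\<close>
    once \<open>\<eta>\<close> is transformed at \<open>v\<close>.\<close>
  define \<psi> where "\<psi> z = exp (- (\<i> * of_real (w * fst z))) * \<phi> (fst z, snd z + t * fst z)" for z
  define C' where "C' = C * (2 * (1 + t\<^sup>2))"
  have \<psi>_cont: "continuous_on UNIV \<psi>"
    unfolding \<psi>_def by (intro continuous_intros continuous_on_compose2[OF cont]) auto
  have \<psi>_le: "norm (\<psi> (x, y)) \<le> C' * lorentz x * lorentz y" for x y
  proof -
    \<comment> \<open>The surplus \<open>lorentz x\<close> absorbs the Peetre factor of the shear,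
      uniformly in \<open>x\<close>; what remains is the constant \<open>2 * (1 + t\<^sup>2)\<close>
      in \<open>C'\<close>.\<close>
    have "lorentz x * (1 + (t * x)\<^sup>2) \<le> lorentz x * ((1 + t\<^sup>2) * (1 + x\<^sup>2))"
      by (intro mult_left_mono) (auto simp: algebra_simps power_mult_distrib)
    also have "\<dots> = 1 + t\<^sup>2"
      using lorentz_pos[of x] by (simp add: lorentz_def)
    finally have 1: "lorentz x * (1 + (t * x)\<^sup>2) \<le> 1 + t\<^sup>2" .
    have "norm (\<psi> (x, y)) \<le> C * (lorentz x)\<^sup>2 * lorentz (y + t * x)"
      unfolding \<psi>_def using C(2) by (simp add: norm_mult)
    also have "\<dots> \<le> C * (lorentz x)\<^sup>2 * (2 * (1 + (t * x)\<^sup>2) * lorentz y)"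
      using C(1) by (intro mult_left_mono lorentz_add_le) auto
    also have "\<dots> = (C * 2 * lorentz x * lorentz y) * (lorentz x * (1 + (t * x)\<^sup>2))"
      by (simp add: power2_eq_square mult_ac)
    also have "\<dots> \<le> (C * 2 * lorentz x * lorentz y) * (1 + t\<^sup>2)"
      using C(1) by (intro mult_left_mono 1) auto
    finally show ?thesis by (simp add: C'_def mult_ac)
  qed
  have C'0: "0 \<le> C'" using C(1) by (simp add: C'_def)
  define \<kappa> where "\<kappa> \<eta> = (LINT \<sigma>|lborel. \<psi> (\<sigma>, \<eta>))" for \<eta>
  have \<kappa>_cont: "continuous_on UNIV \<kappa>"
    unfolding \<kappa>_def
  proof (rule continuous_integral_lorentz)
    show "continuous_on UNIV (\<lambda>(\<eta>, \<sigma>). \<psi> (\<sigma>, \<eta>))"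
      unfolding case_prod_beta by (intro continuous_on_compose2[OF \<psi>_cont] continuous_intros) auto
    show "norm (\<psi> (\<sigma>, \<eta>)) \<le> C' * lorentz \<sigma>" for \<eta> \<sigma>
      using \<psi>_le[of \<sigma> \<eta>] lorentz_le_1[of \<eta>] C'0
      by (meson lorentz_nonneg mult_left_le mult_nonneg_nonneg order_trans)
  qed
  define I where "I = integral\<^sup>L lborel lorentz"
  have I0: "0 \<le> I" unfolding I_def by simp
  have \<kappa>_le: "norm (\<kappa> \<eta>) \<le> C' * I * lorentz \<eta>" for \<eta>
    using norm_integral_lorentz_le[of "\<lambda>\<sigma>. \<psi> (\<sigma>, \<eta>)" "C' * lorentz \<eta>"] \<psi>_le[of _ \<eta>]
    by (simp add: \<kappa>_def I_def mult_ac)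
  have fourier_\<kappa>: "fourier \<kappa> v = fourier \<phi> (w - t * v, v)" for v
  proof -
    have "fourier \<kappa> v = fourier \<psi> (0, v)"
      unfolding fourier_plane(2)[OF \<psi>_cont \<psi>_le] by (simp add: \<kappa>_def[abs_def] fourier_def[of _ "0::real"])
    also have "\<dots> = (LINT \<sigma>|lborel. fourier (\<lambda>\<eta>. \<psi> (\<sigma>, \<eta>)) v)"
      unfolding fourier_plane(1)[OF \<psi>_cont \<psi>_le] by (simp add: fourier_def[of _ "0::real"])
    also have "\<dots> = (LINT \<sigma>|lborel. exp (- (\<i> * of_real ((w - t * v) * \<sigma>))) * fourier (\<lambda>\<eta>. \<phi> (\<sigma>, \<eta>)) v)"
    proof (intro Bochner_Integration.integral_cong refl)
      fix \<sigma>
      have "fourier (\<lambda>\<eta>. \<psi> (\<sigma>, \<eta>)) v =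
          exp (- (\<i> * of_real (w * \<sigma>))) * fourier (\<lambda>\<eta>. \<phi> (\<sigma>, \<eta> + t * \<sigma>)) v"
        unfolding fourier_real integral_mult_right_zero[symmetric] by (simp add: \<psi>_def mult_ac)
      also have "\<dots> = exp (- (\<i> * of_real (w * \<sigma>))) * (exp (\<i> * of_real (v * (t * \<sigma>))) * fourier (\<lambda>\<eta>. \<phi> (\<sigma>, \<eta>)) v)"
        using fourier_translate[of "\<lambda>\<eta>. \<phi> (\<sigma>, \<eta>)" "t * \<sigma>" v] by simp
      also have "\<dots> = exp (- (\<i> * of_real ((w - t * v) * \<sigma>))) * fourier (\<lambda>\<eta>. \<phi> (\<sigma>, \<eta>)) v"
        unfolding mult.assoc[symmetric] exp_add[symmetric] by (simp add: algebra_simps)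
      finally show "fourier (\<lambda>\<eta>. \<psi> (\<sigma>, \<eta>)) v =
          exp (- (\<i> * of_real ((w - t * v) * \<sigma>))) * fourier (\<lambda>\<eta>. \<phi> (\<sigma>, \<eta>)) v" .
    qed
    also have "\<dots> = fourier \<phi> (w - t * v, v)"
      unfolding fourier_plane(1)[OF cont C(3)] by (simp add: fourier_real)
    finally show ?thesis .
  qed
  have "(LINT v|lborel. fourier \<kappa> v) = 2 * pi * \<kappa> 0"
  proof (rule integral_fourier_eq)
    show "norm (\<kappa> x) \<le> C' * I" for x
      using \<kappa>_le[of x] lorentz_le_1[of x] C'0 I0 by (meson mult_left_le mult_nonneg_nonneg order_trans)
    show "integrable lborel \<kappa>"
      using \<kappa>_cont \<kappa>_le by (rule integrable_continuous_lorentz)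
    show "integrable lborel (fourier \<kappa>)"
    proof (rule integrable_continuous_lorentz)
      show "continuous_on UNIV (fourier \<kappa>)"
        by (rule continuous_fourier) fact
      \<comment> \<open>Along the line \<open>(w - t * v, v)\<close> the decay in the second
        coordinate alone is integrable in \<open>v\<close>, whatever \<open>t\<close> is.\<close>
      show "norm (fourier \<kappa> v) \<le> B * lorentz v" for v
        unfolding fourier_\<kappa> using B(2)[of "w - t * v" v] lorentz_le_1[of "w - t * v"] B(1)
        by (meson lorentz_nonneg mult_left_le mult_right_mono order_trans)
    qed
  qed (rule \<kappa>_cont)
  then show ?thesis by (simp add: fourier_\<kappa> \<kappa>_def \<psi>_def)
qed

text \<open>For each \<open>t\<close> the transform of \<open>(u, v) \<mapsto> k(u + tv, t)\<close> is concentrated on the line \<open>\<eta> = t\<sigma>\<close>;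
  the Jacobian of \<open>(\<sigma>, t) \<mapsto> (\<sigma>, t\<sigma>)\<close> produces the factor \<open>1/|\<sigma>|\<close>.\<close>

lemma represents_fourier_ray:
  fixes k :: "real \<times> real \<Rightarrow> complex"
  assumes k_cont: "continuous_on UNIV k"
    and C: "0 \<le> C" "\<And>s t. norm (k (s, t)) \<le> C * lorentz s * lorentz t"
  shows "represents_fourier (\<lambda>(u, v). LINT t|lborel. k (u + t * v, t))
    (\<lambda>(\<sigma>, \<eta>). of_real (2 * pi / \<bar>\<sigma>\<bar>) * fourier (\<lambda>s. k (s, \<eta> / \<sigma>)) \<sigma>)"
proof -
  define F where "F z = (LINT t|lborel. k (fst z + t * snd z, t))" for z
  define K where "K z = fourier (\<lambda>s. k (s, snd z)) (fst z)" for z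
  define G where "G z = of_real (2 * pi / \<bar>fst z\<bar>) * K (fst z, snd z / fst z)" for z
  define I where "I = integral\<^sup>L lborel lorentz"
  have k_le1: "norm (k (s, t)) \<le> C * lorentz s" for s t
    using C lorentz_le_1[of t] by (meson lorentz_nonneg mult_left_le mult_nonneg_nonneg order_trans)
  have k_le2: "norm (k (s, t)) \<le> C * lorentz t" for s t
    using C lorentz_le_1[of s] by (meson lorentz_nonneg mult_left_le mult_right_mono order_trans)
  have I0: "0 \<le> I" unfolding I_def by simp
  have F_cont: "continuous_on UNIV F"
    unfolding F_def case_prod_beta
    by (rule continuous_integral_lorentz[where C=C])
       (auto simp: case_prod_beta intro!: k_le2 continuous_on_compose2[OF k_cont] continuous_intros)
  have F_le: "norm (F z) \<le> C * I" for z
    unfolding F_def I_def by (rule norm_integral_lorentz_le) (rule k_le2)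
  have K_cont: "continuous_on UNIV K"
    unfolding K_def fourier_real
    by (rule continuous_integral_lorentz[where C=C])
       (auto simp: case_prod_beta norm_mult intro!: k_le1 continuous_on_compose2[OF k_cont] continuous_intros)
  have K_le: "norm (K (\<sigma>, t)) \<le> C * I * lorentz t" for \<sigma> t
    using norm_integral_lorentz_le[of "\<lambda>s. exp (- (\<i> * of_real (\<sigma> * s))) * k (s, t)" "C * lorentz t"] C(2)[of _ t]
    by (simp add: K_def fourier_real norm_mult I_def mult_ac)
  have main: "integrable lborel (\<lambda>z. F z * fourier \<phi> z) \<and> integrable lborel (\<lambda>z. G z * \<phi> z) \<and>
      (LINT z|lborel. F z * fourier \<phi> z) = (LINT z|lborel. G z * \<phi> z)" if \<phi>: "schwartz \<phi>" for \<phi>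
  proof (intro conjI)
    obtain B where B: "0 \<le> B" "\<And>x y. norm (\<phi> (x, y)) \<le> B * lorentz x * lorentz y"
      by (rule schwartz_plane_bound[OF \<phi>]) (rule that)
    obtain A where A: "0 \<le> A" "\<And>u v. norm (fourier \<phi> (u, v)) \<le> A * lorentz u * lorentz v"
      by (rule fourier_schwartz_plane_bound[OF \<phi>]) (rule that)
    note \<phi>_cont = schwartz_continuous[OF \<phi>, of UNIV]
    note \<Phi>_cont = continuous_fourier[OF schwartz_integrable_plane[OF \<phi>]]
    have \<Phi>_int: "integrable lborel (fourier \<phi>)"
      using \<Phi>_cont A(2) by (rule integrable_plane_lorentz)
    have \<phi>_le1: "norm (\<phi> (x, y)) \<le> B * lorentz x" for x y
      using B lorentz_le_1[of y] by (meson lorentz_nonneg mult_left_le mult_nonneg_nonneg order_trans)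

    show "integrable lborel (\<lambda>z. F z * fourier \<phi> z)"
    proof (rule integrable_plane_lorentz)
      show "continuous_on UNIV (\<lambda>z. F z * fourier \<phi> z)"
        by (intro continuous_intros F_cont \<Phi>_cont)
      show "norm (F (u, v) * fourier \<phi> (u, v)) \<le> (C * I * A) * lorentz u * lorentz v" for u v
        using mult_mono[OF F_le[of "(u, v)"] A(2)[of u v]] C(1) I0 by (simp add: norm_mult mult_ac)
    qed

    \<comment> \<open>The pullback of \<open>K * \<phi>\<close> under
      \<open>(\<sigma>, t) \<mapsto> (\<sigma>, t * \<sigma>)\<close>. It has no singularity:
      \<open>K\<close> gives decay in \<open>t\<close>, \<open>\<phi>\<close> gives decay in
      \<open>\<sigma>\<close>.\<close>
    define H where "H z = K z * \<phi> (fst z, snd z * fst z)" for z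
    have H_cont: "continuous_on UNIV H"
      unfolding H_def by (intro continuous_intros K_cont continuous_on_compose2[OF \<phi>_cont]) auto
    have H_le: "norm (H (\<sigma>, t)) \<le> (C * I * B) * lorentz \<sigma> * lorentz t" for \<sigma> t
      using mult_mono[OF K_le[of \<sigma> t] \<phi>_le1[of \<sigma> "t * \<sigma>"]] C(1) I0 by (simp add: H_def norm_mult mult_ac)

    have G_slice: "G (\<sigma>, \<sigma> * t) * \<phi> (\<sigma>, \<sigma> * t) = of_real (2 * pi / \<bar>\<sigma>\<bar>) * H (\<sigma>, t)" if "\<sigma> \<noteq> 0" for \<sigma> t
      using that by (simp add: G_def H_def mult.commute)
    have G_slice_int: "integrable lborel (\<lambda>\<eta>. G (\<sigma>, \<eta>) * \<phi> (\<sigma>, \<eta>))" if "\<sigma> \<noteq> 0" for \<sigma>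
    proof -
      have "integrable lborel (\<lambda>t. H (\<sigma>, t))"
        using H_le[of \<sigma>]
        by (intro integrable_continuous_lorentz[where C="C * I * B * lorentz \<sigma>"] continuous_on_compose2[OF H_cont] continuous_intros) auto
      then have "integrable lborel (\<lambda>t. G (\<sigma>, \<sigma> * t) * \<phi> (\<sigma>, \<sigma> * t))"
        unfolding G_slice[OF that] by (rule integrable_mult_right)
      then show ?thesis
        using lborel_integrable_real_affine_iff[OF that, of "\<lambda>\<eta>. G (\<sigma>, \<eta>) * \<phi> (\<sigma>, \<eta>)" 0] by simp
    qed
    \<comment> \<open>Substituting \<open>\<eta> = \<sigma> * t\<close> yields the Jacobian
      \<open>|\<sigma>|\<close>, which cancels the singular factor of \<open>G\<close>. The excluded
      line \<open>\<sigma> = 0\<close> is a null set.\<close>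
    have G_slice_norm: "(LINT \<eta>|lborel. norm (G (\<sigma>, \<eta>) * \<phi> (\<sigma>, \<eta>))) = 2 * pi * (LINT t|lborel. norm (H (\<sigma>, t)))"
      if "\<sigma> \<noteq> 0" for \<sigma>
      by (subst lborel_integral_real_affine[OF that, of _ 0])
         (use that in \<open>simp add: G_slice norm_mult norm_divide\<close>)
    have G_slice_eq: "(LINT \<eta>|lborel. G (\<sigma>, \<eta>) * \<phi> (\<sigma>, \<eta>)) = 2 * pi * (LINT t|lborel. H (\<sigma>, t))"
      if "\<sigma> \<noteq> 0" for \<sigma>
      by (subst lborel_integral_real_affine[OF that, of _ 0])
         (use that in \<open>simp add: G_slice scaleR_conv_of_real\<close>)

    have [measurable]: "K \<in> borel_measurable (borel \<Otimes>\<^sub>M borel)" "\<phi> \<in> borel_measurable (borel \<Otimes>\<^sub>M borel)"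
      using borel_measurable_continuous_onI[OF K_cont] borel_measurable_continuous_onI[OF \<phi>_cont]
      by (simp_all add: borel_prod)
    have "(\<lambda>z. G z * \<phi> z) \<in> borel_measurable (borel \<Otimes>\<^sub>M borel)"
      unfolding G_def by measurable
    then have [measurable]: "(\<lambda>z. G z * \<phi> z) \<in> borel_measurable (lborel \<Otimes>\<^sub>M lborel)"
      by (simp add: lborel_prod borel_prod)
    have H_int: "integrable (lborel \<Otimes>\<^sub>M lborel) H"
      using integrable_plane_lorentz[OF H_cont H_le] by (simp add: lborel_prod)
    have ne: "AE \<sigma> in lborel. (\<sigma>::real) \<noteq> 0" by (rule AE_lborel_singleton)
    have G_int: "integrable (lborel \<Otimes>\<^sub>M lborel) (\<lambda>z. G z * \<phi> z)"
    proof (rule lborel_pair.Fubini_integrable)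
      show "integrable lborel (\<lambda>\<sigma>. LINT \<eta>|lborel. norm (G (\<sigma>, \<eta>) * \<phi> (\<sigma>, \<eta>)))"
      proof (rule integrable_cong_AE_imp)
        show "integrable lborel (\<lambda>\<sigma>. 2 * pi * (LINT t|lborel. norm (H (\<sigma>, t))))"
          using lborel_pair.integrable_fst'[OF integrable_norm[OF H_int]] by (rule integrable_mult_right)
        show "AE \<sigma> in lborel. 2 * pi * (LINT t|lborel. norm (H (\<sigma>, t))) = (LINT \<eta>|lborel. norm (G (\<sigma>, \<eta>) * \<phi> (\<sigma>, \<eta>)))"
          using ne by eventually_elim (rule G_slice_norm[symmetric])
      qed measurable
      show "AE \<sigma> in lborel. integrable lborel (\<lambda>\<eta>. G (\<sigma>, \<eta>) * \<phi> (\<sigma>, \<eta>))"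
        using ne by eventually_elim (rule G_slice_int)
    qed measurable
    then show "integrable lborel (\<lambda>z. G z * \<phi> z)" by (simp add: lborel_prod)

    \<comment> \<open>The contribution of one value of \<open>t\<close>. The variables are
      rearranged until \<open>v\<close> is innermost with \<open>w = u + t * v\<close> fixed, where
      \<open>integral_fourier_line\<close> applies.\<close>
    have slice: "(LINT z|lborel. k (fst z + t * snd z, t) * fourier \<phi> z) = 2 * pi * (LINT \<sigma>|lborel. H (\<sigma>, t))" for t
    proof -
      have "(LINT z|lborel. k (fst z + t * snd z, t) * fourier \<phi> z) =
          (LINT u|lborel. LINT v|lborel. k (u + t * v, t) * fourier \<phi> (u, v))"
      proof (subst integral_plane_lorentz[where C="C * A"])
        show "norm (k (fst (x, y) + t * snd (x, y), t) * fourier \<phi> (x, y)) \<le> C * A * lorentz x * lorentz y" for x y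
          using mult_mono[OF order_trans[OF k_le1[of "x + t * y" t] mult_left_le[OF lorentz_le_1 C(1)]] A(2)[of x y]] C(1)
          by (simp add: norm_mult mult_ac)
      qed (auto intro!: continuous_intros continuous_on_compose2[OF k_cont] \<Phi>_cont)
      also have "\<dots> = (LINT v|lborel. LINT u|lborel. k (u + t * v, t) * fourier \<phi> (u, v))"
      proof (rule integral_swap_lorentz[where C="C * A"])
        show "norm (k (x + t * y, t) * fourier \<phi> (x, y)) \<le> C * A * lorentz x * lorentz y" for x y
          using mult_mono[OF order_trans[OF k_le1[of "x + t * y" t] mult_left_le[OF lorentz_le_1 C(1)]] A(2)[of x y]] C(1)
          by (simp add: norm_mult mult_ac)
      qed (auto simp: case_prod_beta intro!: continuous_intros continuous_on_compose2[OF k_cont] \<Phi>_cont)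
      also have "\<dots> = (LINT v|lborel. LINT w|lborel. k (w, t) * fourier \<phi> (w - t * v, v))"
      proof (rule Bochner_Integration.integral_cong[OF refl])
        fix v
        show "(LINT u|lborel. k (u + t * v, t) * fourier \<phi> (u, v)) = (LINT w|lborel. k (w, t) * fourier \<phi> (w - t * v, v))"
          by (subst lborel_integral_real_affine[of 1 _ "- t * v"]) auto
      qed
      also have "\<dots> = (LINT w|lborel. LINT v|lborel. k (w, t) * fourier \<phi> (w - t * v, v))"
      proof (rule integral_swap_lorentz[where C="C * A"])
        \<comment> \<open>After the shear, decay in \<open>w\<close> is taken from \<open>k\<close>
          and decay in \<open>v\<close> from the transform of \<open>\<phi>\<close>.\<close>
        show "norm (k (w, t) * fourier \<phi> (w - t * v, v)) \<le> C * A * lorentz v * lorentz w" for v w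
        proof -
          have "norm (fourier \<phi> (w - t * v, v)) \<le> A * lorentz v"
            using A(2)[of "w - t * v" v] lorentz_le_1[of "w - t * v"] A(1)
            by (meson lorentz_nonneg mult_left_le mult_right_mono order_trans)
          from mult_mono[OF k_le1[of w t] this] C(1) show ?thesis by (simp add: norm_mult mult_ac)
        qed
      qed (auto simp: case_prod_beta intro!: continuous_intros continuous_on_compose2[OF k_cont] continuous_on_compose2[OF \<Phi>_cont])
      also have "\<dots> = (LINT w|lborel. 2 * pi * (LINT \<sigma>|lborel. k (w, t) * (exp (- (\<i> * of_real (w * \<sigma>))) * \<phi> (\<sigma>, t * \<sigma>))))"
        by (simp add: integral_fourier_line[OF \<phi>] mult.left_commute)
      also have "\<dots> = 2 * pi * (LINT w|lborel. LINT \<sigma>|lborel. k (w, t) * (exp (- (\<i> * of_real (w * \<sigma>))) * \<phi> (\<sigma>, t * \<sigma>)))"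
        by (rule integral_mult_right_zero)
      also have "(LINT w|lborel. LINT \<sigma>|lborel. k (w, t) * (exp (- (\<i> * of_real (w * \<sigma>))) * \<phi> (\<sigma>, t * \<sigma>))) =
          (LINT \<sigma>|lborel. LINT w|lborel. k (w, t) * (exp (- (\<i> * of_real (w * \<sigma>))) * \<phi> (\<sigma>, t * \<sigma>)))"
      proof (rule integral_swap_lorentz[where C="C * B"])
        show "norm (k (w, t) * (exp (- (\<i> * of_real (w * \<sigma>))) * \<phi> (\<sigma>, t * \<sigma>))) \<le> C * B * lorentz w * lorentz \<sigma>" for w \<sigma>
          using mult_mono[OF k_le1[of w t] \<phi>_le1[of \<sigma> "t * \<sigma>"]] C(1) by (simp add: norm_mult mult_ac)
      qed (auto simp: case_prod_beta intro!: continuous_intros continuous_on_compose2[OF k_cont] continuous_on_compose2[OF \<phi>_cont])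
      also have "\<dots> = (LINT \<sigma>|lborel. H (\<sigma>, t))"
        unfolding H_def K_def fourier_real integral_mult_left_zero[symmetric] by (simp add: mult_ac)
      finally show ?thesis .
    qed

    have "(LINT z|lborel. F z * fourier \<phi> z) = (LINT z|lborel. LINT t|lborel. k (fst z + t * snd z, t) * fourier \<phi> z)"
      by (simp add: F_def)
    also have "\<dots> = (LINT t|lborel. LINT z|lborel. k (fst z + t * snd z, t) * fourier \<phi> z)"
    \<comment> \<open>Here \<open>k\<close> must give decay in \<open>t\<close>, so it gives none in
      \<open>z\<close>; integrability in \<open>z\<close> rests on the transform of
      \<open>\<phi>\<close> alone.\<close>
    proof (rule integral_swap_dominated[OF _ integrable_mult_right[OF integrable_norm[OF \<Phi>_int], of C] integrable_lorentz])
      show "norm (k (fst z + t * snd z, t) * fourier \<phi> z) \<le> C * norm (fourier \<phi> z) * lorentz t" for z t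
        using mult_right_mono[OF k_le2[of "fst z + t * snd z" t], of "norm (fourier \<phi> z)"]
        by (simp add: norm_mult mult_ac)
    qed (auto simp: case_prod_beta intro!: continuous_intros continuous_on_compose2[OF k_cont] continuous_on_compose2[OF \<Phi>_cont])
    also have "\<dots> = (LINT t|lborel. 2 * pi * (LINT \<sigma>|lborel. H (\<sigma>, t)))"
      unfolding slice ..
    also have "\<dots> = 2 * pi * (LINT t|lborel. LINT \<sigma>|lborel. H (\<sigma>, t))"
      by (rule integral_mult_right_zero)
    also have "(LINT t|lborel. LINT \<sigma>|lborel. H (\<sigma>, t)) = (LINT \<sigma>|lborel. LINT t|lborel. H (\<sigma>, t))"
      using H_cont H_le by (intro integral_swap_lorentz[symmetric, where C="C * I * B"]) auto
    also have "2 * pi * (LINT \<sigma>|lborel. LINT t|lborel. H (\<sigma>, t)) = (LINT \<sigma>|lborel. 2 * pi * (LINT t|lborel. H (\<sigma>, t)))"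
      by (rule integral_mult_right_zero[symmetric])
    also have "\<dots> = (LINT \<sigma>|lborel. LINT \<eta>|lborel. G (\<sigma>, \<eta>) * \<phi> (\<sigma>, \<eta>))"
    proof (rule integral_cong_AE)
      show "(\<lambda>\<sigma>. 2 * pi * (LINT t|lborel. H (\<sigma>, t))) \<in> borel_measurable lborel"
        using lborel_pair.integrable_fst'[OF H_int] by auto
      show "(\<lambda>\<sigma>. LINT \<eta>|lborel. G (\<sigma>, \<eta>) * \<phi> (\<sigma>, \<eta>)) \<in> borel_measurable lborel"
        using lborel_pair.integrable_fst'[OF G_int] by auto
      show "AE \<sigma> in lborel. 2 * pi * (LINT t|lborel. H (\<sigma>, t)) = (LINT \<eta>|lborel. G (\<sigma>, \<eta>) * \<phi> (\<sigma>, \<eta>))"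
        using ne by eventually_elim (rule G_slice_eq[symmetric])
    qed
    also have "\<dots> = (LINT z|lborel. G z * \<phi> z)"
      using lborel_pair.integral_fst'[OF G_int] by (simp add: lborel_prod)
    finally show "(LINT z|lborel. F z * fourier \<phi> z) = (LINT z|lborel. G z * \<phi> z)" .
  qed
  have "(\<lambda>(u, v). LINT t|lborel. k (u + t * v, t)) = F"
    "(\<lambda>(\<sigma>, \<eta>). of_real (2 * pi / \<bar>\<sigma>\<bar>) * fourier (\<lambda>s. k (s, \<eta> / \<sigma>)) \<sigma>) = G"
    by (auto simp: F_def G_def K_def)
  with main show ?thesis unfolding represents_fourier_def by simp
qed

text \<open>The partial transform of \<open>k\<close> is jointly continuous by domination; composing
  it with \<open>(\<sigma>, \<eta>) \<mapsto> (\<sigma>, \<eta> / \<sigma>)\<close> keeps continuity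
  wherever the division is continuous.\<close>

lemma isCont_fourier_slice:
  fixes k :: "real \<times> real \<Rightarrow> complex"
  assumes cont: "continuous_on UNIV k" and bnd: "\<And>s t. norm (k (s, t)) \<le> C * lorentz s" and "fst z \<noteq> 0"
  shows "isCont (\<lambda>(\<sigma>, \<eta>). of_real (2 * pi / \<bar>\<sigma>\<bar>) * fourier (\<lambda>s. k (s, \<eta> / \<sigma>)) \<sigma>) z"
proof -
  have "continuous_on UNIV (\<lambda>z. fourier (\<lambda>s. k (s, snd z)) (fst z))"
    unfolding fourier_real
    by (rule continuous_integral_lorentz[where C=C])
       (auto simp: case_prod_beta norm_mult intro!: bnd continuous_on_compose2[OF cont] continuous_intros)
  then have "isCont (\<lambda>z. fourier (\<lambda>s. k (s, snd z)) (fst z)) (fst z, snd z / fst z)"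
    by (simp add: continuous_on_eq_continuous_at)
  moreover have "isCont (\<lambda>z. (fst z, snd z / fst z)) z"
    using assms(3) by (intro continuous_intros) auto
  ultimately have "isCont (\<lambda>z. fourier (\<lambda>s. k (s, snd z / fst z)) (fst z)) z"
    using isCont_o2[of z "\<lambda>z. (fst z, snd z / fst z)"] by fastforce
  then show ?thesis
    unfolding case_prod_beta using assms(3) by (intro continuous_intros) auto
qed

section \<open>Coordinates of the ray and the theorem\<close>

lemma continuous_on_join1 [continuous_intros]:
  assumes "continuous_on A f" "continuous_on A g"
  shows "continuous_on A (\<lambda>z. join1 (f z) (g z))"
  unfolding join1_def
proof (rule continuous_on_vec_lambda)
  show "continuous_on A (\<lambda>z. if i = 1 then f z else g z $ i)" for i
    using assms by (cases "i = 1") (auto intro!: continuous_intros)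
qed

lemma abs_le_norm_join1: "\<bar>s\<bar> \<le> norm (join1 s x)"
  using component_le_norm_cart[of "join1 s x" 1] by (simp add: join1_def)

text \<open>Along the ray the first coordinate and the transverse part move independently, which
  lets the slice be written with \<open>k (u + t * v, t)\<close>.\<close>

lemma join1_add_scaleR: "join1 a x + t *\<^sub>R join1 b y = join1 (a + t * b) (x + t *\<^sub>R y)"
  by (simp add: join1_def vec_eq_iff)

text \<open>The existence conjunct certifies that \<open>fourier_distr\<close> denotes a genuine
  value here and not the arbitrary result of an unsatisfied definite description.\<close>

theorem theorem4:
  fixes h :: "real \<Rightarrow> complex" and f :: "real^'n::{finite,one} \<Rightarrow> complex"
    and a \<sigma> :: real and u' v' :: "real^'n::{finite,one}"
  assumes "schwartz h" and "h a \<noteq> 0" and "schwartz f" and "\<sigma> \<noteq> 0"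
  shows "(\<exists>c. has_fourier_value (windowed_ray_slice h f u' v') (\<sigma>, a * \<sigma>) c) \<and>
         of_real \<bar>\<sigma>\<bar> * fourier_distr (windowed_ray_slice h f u' v') (\<sigma>, a * \<sigma>) =
           2 * of_real pi * fourier_x1 f \<sigma> (a *\<^sub>R v' + u') * h a"
proof -
  define k where "k z = f (join1 (fst z) (u' + snd z *\<^sub>R v')) * h (snd z)" for z
  define G where "G = (\<lambda>(\<sigma>, \<eta>). of_real (2 * pi / \<bar>\<sigma>\<bar>) * fourier (\<lambda>s. k (s, \<eta> / \<sigma>)) \<sigma>)"
  obtain A where A: "0 \<le> A" "\<And>x. norm (f x) \<le> A * lorentz (norm x)"
    using schwartz_lorentz_bound[OF assms(3)] by blast
  obtain B where B: "0 \<le> B" "\<And>x. norm (h x) \<le> B * lorentz (norm x)"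
    using schwartz_lorentz_bound[OF assms(1)] by blast
  have AB: "0 \<le> A * B" using A(1) B(1) by simp
  have k_cont: "continuous_on UNIV k"
    unfolding k_def
    by (intro continuous_intros continuous_on_compose2[OF schwartz_continuous[OF assms(3), of UNIV]]
        continuous_on_compose2[OF schwartz_continuous[OF assms(1), of UNIV]]) auto
  have k_le: "norm (k (s, t)) \<le> A * B * lorentz s * lorentz t" for s t
  proof -
    let ?x = "join1 s (u' + t *\<^sub>R v')"
    \<comment> \<open>Decay in \<open>s\<close> comes from \<open>f\<close>, since the first
      coordinate is bounded by the norm; decay in \<open>t\<close> comes from the window
      \<open>h\<close>.\<close>
    have "s\<^sup>2 \<le> (norm ?x)\<^sup>2"
      using power_mono[OF abs_le_norm_join1[of s "u' + t *\<^sub>R v'"], of 2] by simp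
    then have "lorentz (norm ?x) \<le> lorentz s"
      unfolding lorentz_def by (intro le_imp_inverse_le) (auto simp: add_pos_nonneg)
    then have "A * lorentz (norm ?x) \<le> A * lorentz s"
      using A(1) by (rule mult_left_mono)
    then have "norm (f ?x) \<le> A * lorentz s"
      using A(2)[of ?x] by linarith
    moreover have "norm (h t) \<le> B * lorentz t"
      using B(2)[of t] by (simp add: lorentz_def)
    ultimately have "norm (f ?x) * norm (h t) \<le> (A * lorentz s) * (B * lorentz t)"
      using A(1) by (intro mult_mono) auto
    then show ?thesis by (simp add: k_def norm_mult mult_ac)
  qed
  have k_le': "norm (k (s, t)) \<le> A * B * lorentz s" for s t
    using k_le[of s t] lorentz_le_1[of t] AB
    by (meson lorentz_nonneg mult_left_le mult_nonneg_nonneg order_trans)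
  have "windowed_ray_slice h f u' v' = (\<lambda>(u, v). LINT t|lborel. k (u + t * v, t))"
    by (simp add: windowed_ray_slice_def windowed_ray_def k_def join1_add_scaleR)
  then have rep: "represents_fourier (windowed_ray_slice h f u' v') G"
    unfolding G_def using represents_fourier_ray[OF k_cont AB k_le] by simp
  have cont: "isCont G (\<sigma>, a * \<sigma>)"
    unfolding G_def using assms(4) by (intro isCont_fourier_slice[OF k_cont k_le']) simp
  \<comment> \<open>At \<open>\<eta> = a * \<sigma>\<close> the quotient
    \<open>\<eta> / \<sigma>\<close> is \<open>a\<close>, so only the slice \<open>t = a\<close> of
    \<open>k\<close> enters and the constant \<open>h a\<close> leaves the integral.\<close>
  have "of_real \<bar>\<sigma>\<bar> * G (\<sigma>, a * \<sigma>) = 2 * of_real pi * fourier_x1 f \<sigma> (a *\<^sub>R v' + u') * h a"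
    using assms(4)
    by (simp add: G_def k_def fourier_x1_def fourier_real mult.assoc[symmetric] add.commute)
  then show ?thesis
    using rep cont fourier_distr_eqI[OF rep cont] unfolding has_fourier_value_def by auto
qed

end
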